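(* Let $A$ be a finite-dimensional algebra over a field $k$. Every finite-dimensional right $A$-module $M$ has finitely many brick chain filtrations. Moreover, only finitely many isomorphism classes of bricks occur in the types of the brick chain filtrations of $M$.
   Context: A brick is a module whose endomorphism ring is a division ring. For a brick $B$, $\mathsf{Filt}\,B$ is the class of modules admitting a finite filtration by submodules all of whose successive factors are isomorphic to $B$ (including the zero module). A brick chain filtration of $M$ is a chain of submodules $0=M_0\subsetneq M_1\subsetneq\cdots\subsetneq M_t=M$ for which there exist bricks $B_1,\ldots,B_t$ with $M_i/M_{i-1}\in\mathsf{Filt}\,B_i$ for all $i$ and $\operatorname{Hom}_A(B_i,B_j)=0$ for all $i<j$ (for $M=0$ the empty chain is the only one). Filtrations are counted as actual chains of submodules. The type of the filtration is the ordered sequence of isomorphism classes $([B_1],\ldots,[B_t])$; it is known that if a nonzero module belongs to both $\mathsf{Filt}\,B$ and $\mathsf{Filt}\,C$ for bricks $B,C$, then $B\simeq C$, so the type is determined by the chain. *)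

theory Defs
  imports "HOL-Algebra.Module" "HOL-Algebra.AbelCoset"
begin

text \<open>
  Rings, fields and modules follow the carrier-based style of HOL-Algebra. The library's
  locale \<open>algebra\<close> covers only commutative algebras and its \<open>module\<close> only modules
  over commutative rings, so associative algebras and right modules are introduced here.
\<close>

section \<open>Finite-dimensional algebras\<close>

definition finitely_spanned :: "('k, 'l) ring_scheme \<Rightarrow> ('k, 'v, 'e) module_scheme \<Rightarrow> bool" where
  "finitely_spanned K V \<longleftrightarrow>
     (\<exists>S. finite S \<and> S \<subseteq> carrier V \<and>
        (\<forall>v \<in> carrier V. \<exists>c \<in> S \<rightarrow> carrier K. v = (\<Oplus>\<^bsub>V\<^esub>s\<in>S. c s \<odot>\<^bsub>V\<^esub> s)))"

text \<open>Associative and unital; the zero algebra is allowed.\<close>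

locale fin_dim_algebra = K: field K + module K A + A: ring A for K and A (structure) +
  assumes smult_mult_left:
      "\<lbrakk>c \<in> carrier K; a \<in> carrier A; b \<in> carrier A\<rbrakk> \<Longrightarrow> (c \<odot> a) \<otimes> b = c \<odot> (a \<otimes> b)"
    and smult_mult_right:
      "\<lbrakk>c \<in> carrier K; a \<in> carrier A; b \<in> carrier A\<rbrakk> \<Longrightarrow> a \<otimes> (c \<odot> b) = c \<odot> (a \<otimes> b)"
    and fin_dim: "finitely_spanned K A"


section \<open>Right modules\<close>

text \<open>As in the library's record \<open>module\<close>, the fields \<open>mult\<close> and \<open>one\<close> inherited from
  \<open>ring\<close> are not used; \<open>x \<triangleleft> a\<close> is the action of the scalar \<open>a\<close> on \<open>x\<close> from the right.\<close>

record ('a, 'm) rmod = "'m ring" +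
  ract :: "'m \<Rightarrow> 'a \<Rightarrow> 'm" (infixl "\<triangleleft>\<index>" 70)

locale right_module = A?: ring A + M?: abelian_group M
  for A :: "('a, 'e) ring_scheme" and M :: "('a, 'm) rmod" (structure) +
  assumes ract_closed:
      "\<lbrakk>x \<in> carrier M; a \<in> carrier A\<rbrakk> \<Longrightarrow> x \<triangleleft> a \<in> carrier M"
    and ract_add_left:
      "\<lbrakk>x \<in> carrier M; y \<in> carrier M; a \<in> carrier A\<rbrakk> \<Longrightarrow> (x \<oplus> y) \<triangleleft> a = x \<triangleleft> a \<oplus> y \<triangleleft> a"
    and ract_add_right:
      "\<lbrakk>x \<in> carrier M; a \<in> carrier A; b \<in> carrier A\<rbrakk> \<Longrightarrow> x \<triangleleft> (a \<oplus>\<^bsub>A\<^esub> b) = x \<triangleleft> a \<oplus> x \<triangleleft> b"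
    and ract_mult:
      "\<lbrakk>x \<in> carrier M; a \<in> carrier A; b \<in> carrier A\<rbrakk> \<Longrightarrow> x \<triangleleft> (a \<otimes>\<^bsub>A\<^esub> b) = (x \<triangleleft> a) \<triangleleft> b"
    and ract_one:
      "x \<in> carrier M \<Longrightarrow> x \<triangleleft> \<one>\<^bsub>A\<^esub> = x"

text \<open>The underlying vector space of a right module over an algebra: \<open>c\<close> acts as \<open>c \<cdot> 1\<close>.\<close>

definition underlying_space ::
    "('k, 'a, 'e) module_scheme \<Rightarrow> ('a, 'm) rmod \<Rightarrow> ('k, 'm) module" where
  "underlying_space A M =
     \<lparr>carrier = carrier M, mult = mult M, one = one M, zero = zero M, add = add M,
      smult = (\<lambda>c x. x \<triangleleft>\<^bsub>M\<^esub> (c \<odot>\<^bsub>A\<^esub> \<one>\<^bsub>A\<^esub>))\<rparr>"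

definition fin_dim_module ::
    "('k, 'l) ring_scheme \<Rightarrow> ('k, 'a, 'e) module_scheme \<Rightarrow> ('a, 'm) rmod \<Rightarrow> bool" where
  "fin_dim_module K A M \<longleftrightarrow> right_module A M \<and> finitely_spanned K (underlying_space A M)"

definition right_submodule ::
    "('a, 'e) ring_scheme \<Rightarrow> ('a, 'm) rmod \<Rightarrow> 'm set \<Rightarrow> bool" where
  "right_submodule A M N \<longleftrightarrow>
     additive_subgroup N M \<and> (\<forall>x \<in> N. \<forall>a \<in> carrier A. x \<triangleleft>\<^bsub>M\<^esub> a \<in> N)"

text \<open>The factor module \<open>N / L\<close> for submodules \<open>L \<subseteq> N\<close> of \<open>M\<close>; its elements are the cosets
  of \<open>L\<close> in \<open>N\<close>.\<close>

definition factor_module ::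
    "('a, 'm) rmod \<Rightarrow> 'm set \<Rightarrow> 'm set \<Rightarrow> ('a, 'm set) rmod" where
  "factor_module M N L =
     \<lparr>carrier = a_rcosets\<^bsub>M\<lparr>carrier := N\<rparr>\<^esub> L,
      mult = undefined, one = undefined,
      zero = L, add = set_add M,
      ract = (\<lambda>X a. \<Union>x\<in>X. L +>\<^bsub>M\<^esub> (x \<triangleleft>\<^bsub>M\<^esub> a))\<rparr>"

text \<open>Homomorphisms are extensional functions, so that two of them are equal as soon as they
  agree on the carrier.\<close>

definition rmod_hom ::
    "('a, 'e) ring_scheme \<Rightarrow> ('a, 'm) rmod \<Rightarrow> ('a, 'n) rmod \<Rightarrow> ('m \<Rightarrow> 'n) set" where
  "rmod_hom A M N =
     {f \<in> carrier M \<rightarrow>\<^sub>E carrier N.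
        (\<forall>x \<in> carrier M. \<forall>y \<in> carrier M. f (x \<oplus>\<^bsub>M\<^esub> y) = f x \<oplus>\<^bsub>N\<^esub> f y) \<and>
        (\<forall>x \<in> carrier M. \<forall>a \<in> carrier A. f (x \<triangleleft>\<^bsub>M\<^esub> a) = f x \<triangleleft>\<^bsub>N\<^esub> a)}"

definition zero_hom :: "('a, 'm) rmod \<Rightarrow> ('a, 'n) rmod \<Rightarrow> 'm \<Rightarrow> 'n" where
  "zero_hom M N = (\<lambda>x \<in> carrier M. \<zero>\<^bsub>N\<^esub>)"

definition rmod_iso ::
    "('a, 'e) ring_scheme \<Rightarrow> ('a, 'm) rmod \<Rightarrow> ('a, 'n) rmod \<Rightarrow> bool" where
  "rmod_iso A M N \<longleftrightarrow> (\<exists>f \<in> rmod_hom A M N. bij_betw f (carrier M) (carrier N))"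

definition iso_class ::
    "('a, 'e) ring_scheme \<Rightarrow> ('a, 'm) rmod \<Rightarrow> ('a, 'm) rmod set" where
  "iso_class A M = {N. right_module A N \<and> rmod_iso A M N}"

definition End_ring ::
    "('a, 'e) ring_scheme \<Rightarrow> ('a, 'm) rmod \<Rightarrow> ('m \<Rightarrow> 'm) ring" where
  "End_ring A M =
     \<lparr>carrier = rmod_hom A M M,
      mult = compose (carrier M),
      one = (\<lambda>x \<in> carrier M. x),
      zero = zero_hom M M,
      add = (\<lambda>f g. \<lambda>x \<in> carrier M. f x \<oplus>\<^bsub>M\<^esub> g x)\<rparr>"


section \<open>Bricks and brick chain filtrations\<close>

definition division_ring :: "('r, 'e) ring_scheme \<Rightarrow> bool" where
  "division_ring R \<longleftrightarrow> ring R \<and> \<one>\<^bsub>R\<^esub> \<noteq> \<zero>\<^bsub>R\<^esub> \<and> Units R = carrier R - {\<zero>\<^bsub>R\<^esub>}"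

definition brick :: "('a, 'e) ring_scheme \<Rightarrow> ('a, 'b) rmod \<Rightarrow> bool" where
  "brick A B \<longleftrightarrow> right_module A B \<and> division_ring (End_ring A B)"

text \<open>A chain \<open>N\<^sub>0 \<subseteq> \<dots> \<subseteq> N\<^sub>n\<close> of submodules is the list \<open>[N\<^sub>0, \<dots>, N\<^sub>n]\<close> of length \<open>n + 1\<close>.\<close>

definition submodule_chain ::
    "('a, 'e) ring_scheme \<Rightarrow> ('a, 'm) rmod \<Rightarrow> 'm set list \<Rightarrow> bool" where
  "submodule_chain A M Ns \<longleftrightarrow>
     Ns \<noteq> [] \<and> hd Ns = {\<zero>\<^bsub>M\<^esub>} \<and> last Ns = carrier M \<and>
     (\<forall>N \<in> set Ns. right_submodule A M N) \<and>
     (\<forall>i. Suc i < length Ns \<longrightarrow> Ns ! i \<subseteq> Ns ! Suc i)"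

definition Filt :: "('a, 'e) ring_scheme \<Rightarrow> ('a, 'b) rmod \<Rightarrow> ('a, 'm) rmod set" where
  "Filt A B =
     {X. right_module A X \<and>
        (\<exists>Ns. submodule_chain A X Ns \<and>
           (\<forall>i. Suc i < length Ns \<longrightarrow> rmod_iso A (factor_module X (Ns ! Suc i) (Ns ! i)) B))}"

text \<open>\<open>brick_chain_filtration A M Ms Bs\<close>: the chain \<open>Ms = [M\<^sub>0, \<dots>, M\<^sub>t]\<close> is a brick chain
  filtration of \<open>M\<close>, witnessed by the bricks \<open>Bs = [B\<^sub>1, \<dots>, B\<^sub>t]\<close>; thus \<open>B\<^sub>i\<close> is \<open>Bs ! (i - 1)\<close>.
  The bricks have their elements in a type \<open>'b\<close> unrelated to that of \<open>M\<close>. Statements about all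
  brick chain filtrations are to be made for every \<open>'b\<close>, as there is no quantification over types
  inside a formula.\<close>

definition brick_chain_filtration ::
    "('a, 'e) ring_scheme \<Rightarrow> ('a, 'm) rmod \<Rightarrow> 'm set list \<Rightarrow> ('a, 'b) rmod list \<Rightarrow> bool" where
  "brick_chain_filtration A M Ms Bs \<longleftrightarrow>
     submodule_chain A M Ms \<and> length Ms = Suc (length Bs) \<and>
     (\<forall>i < length Bs. Ms ! i \<subset> Ms ! Suc i) \<and>
     (\<forall>B \<in> set Bs. brick A B) \<and>
     (\<forall>i < length Bs. factor_module M (Ms ! Suc i) (Ms ! i) \<in> Filt A (Bs ! i)) \<and>
     (\<forall>i j. i < j \<and> j < length Bs \<longrightarrow>
        rmod_hom A (Bs ! i) (Bs ! j) = {zero_hom (Bs ! i) (Bs ! j)})"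

definition filtration_type ::
    "('a, 'e) ring_scheme \<Rightarrow> ('a, 'b) rmod list \<Rightarrow> ('a, 'b) rmod set list" where
  "filtration_type A Bs = map (iso_class A) Bs"

end

theory Submission
  imports Defs
begin

text \<open>
  If \<open>N = M\<^sub>i\<close> occurs in a brick chain filtration, then \<open>Hom(N, M / N) = 0\<close>, since \<open>N\<close> is filtered
  by \<open>B\<^sub>1, \<dots>, B\<^sub>i\<close> and \<open>M / N\<close> by the later bricks. The space \<open>Hom(N, M / N)\<close> is the tangent space
  at \<open>N\<close> of the variety of submodules of \<open>M\<close>, so such an \<open>N\<close> is an isolated point of it and there
  are only finitely many. To avoid algebraic geometry, attach to submodules \<open>X, Y\<close> a linear system,
  essentially the one describing \<open>Hom(Y, M / X)\<close>, whose coefficients are finite sums of products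
  \<open>c(X) u(Y)\<close>. It has only the zero solution for \<open>X = Y\<close>, and a nonzero one (the map
  \<open>Y \<rightarrow> M \<rightarrow> M / X\<close>) if \<open>Y\<close> is not contained in \<open>X\<close>. Elimination gives \<open>D(X, Y)\<close> of the same form with
  \<open>D(X, X) \<noteq> 0\<close>, and \<open>D(X, Y) = 0\<close> in the second case. Then \<open>D(X, Y) D(Y, X)\<close> is a diagonal
  matrix of finite rank without zeros on the diagonal, so its index set is finite.

  A module determines the brick \<open>B\<close> with respect to which it is filtered, so finitely many
  chains involve finitely many classes of bricks.
\<close>

text \<open>In a finite sum of products \<open>c(X) u(Y)\<close> the factors are arbitrary functions
  of one submodule each. So a projection onto every submodule may be chosen at will, with no
  regularity in the submodule, and the coefficients built from it still have finite rank; this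
  replaces the algebraic structure on the variety. The spaces \<open>Y\<close> and
  \<open>M / X\<close> vary with the pair, whereas elimination needs one fixed set of unknowns.
  Hence a map from \<open>Y\<close> to \<open>M / X\<close> is represented by an endomorphism of the
  whole space, made unique by requiring that it factor through the chosen projection onto
  \<open>Y\<close> and take values in the chosen complement of \<open>X\<close>. The unknowns are
  its matrix entries; a finite spanning set of \<open>A\<close> keeps the number of equations
  finite. Functions of finite rank are closed under sums and products but not under division, so the
  elimination multiplies by pivots and never divides by them as functions of \<open>(X, Y)\<close>.
  The vanishing of \<open>D(X, Y)\<close> is one-sided: it may be nonzero when \<open>Y\<close> lies
  strictly inside \<open>X\<close>. Of two distinct submodules at least one is not contained in the
  other, which is why the product with the transpose is diagonal.\<close>

lemma (in abelian_group) minus_eq_zero_iff: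
  assumes "x \<in> carrier G" "y \<in> carrier G"
  shows "x \<ominus> y = \<zero> \<longleftrightarrow> x = y"
  using assms by (metis a_inv_closed minus_eq minus_equality minus_minus r_neg)

lemma (in abelian_group) diff_zero [simp]: "x \<in> carrier G \<Longrightarrow> x \<ominus> \<zero> = x"
  by (metis l_zero minus_eq minus_equality r_zero zero_closed)


section \<open>Kernels of finite rank\<close>

context field
begin

text \<open>A matrix indexed by a possibly infinite type, written as a finite sum of rank one
  matrices. The index runs over the whole type, so values in the field are available without
  membership conditions, and the inductive form allows induction on the number of summands.\<close>

inductive fin_rank :: "('x \<Rightarrow> 'x \<Rightarrow> 'a) \<Rightarrow> bool" where
  fin_rank_zero: "fin_rank (\<lambda>X Y. \<zero>)"
| fin_rank_rank1: "\<lbrakk>fin_rank h; range c \<subseteq> carrier R; range u \<subseteq> carrier R\<rbrakk>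
    \<Longrightarrow> fin_rank (\<lambda>X Y. h X Y \<oplus> c X \<otimes> u Y)"

lemma fin_rank_closed: "fin_rank h \<Longrightarrow> h X Y \<in> carrier R"
  by (induction rule: fin_rank.induct) (auto simp: image_subset_iff)

lemma fin_rank_add:
  assumes "fin_rank h" "fin_rank g"
  shows "fin_rank (\<lambda>X Y. h X Y \<oplus> g X Y)"
  using assms(2)
proof induction
  case fin_rank_zero
  have "(\<lambda>X Y. h X Y \<oplus> \<zero>) = h"
    using assms(1) by (auto simp: fun_eq_iff fin_rank_closed)
  then show ?case using assms(1) by simp
next
  case (fin_rank_rank1 g c u)
  have "(\<lambda>X Y. h X Y \<oplus> (g X Y \<oplus> c X \<otimes> u Y)) = (\<lambda>X Y. (h X Y \<oplus> g X Y) \<oplus> c X \<otimes> u Y)"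
    using fin_rank_rank1 assms(1)
    by (auto simp: fun_eq_iff fin_rank_closed image_subset_iff a_assoc)
  then show ?case
    using fin_rank.fin_rank_rank1[OF fin_rank_rank1(4,2,3)] by simp
qed

lemma fin_rank_prod:
  assumes "range c \<subseteq> carrier R" "range u \<subseteq> carrier R"
  shows "fin_rank (\<lambda>X Y. c X \<otimes> u Y)"
proof -
  have "(\<lambda>X Y. \<zero> \<oplus> c X \<otimes> u Y) = (\<lambda>X Y. c X \<otimes> u Y)"
    using assms by (auto simp: fun_eq_iff image_subset_iff)
  then show ?thesis
    using fin_rank_rank1[OF fin_rank_zero assms] by simp
qed

lemma fin_rank_const: "a \<in> carrier R \<Longrightarrow> fin_rank (\<lambda>X Y. a)"
  using fin_rank_prod[of "\<lambda>_. a" "\<lambda>_. \<one>"] by auto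

lemma fin_rank_mult_rank1:
  assumes "fin_rank h" "range c \<subseteq> carrier R" "range u \<subseteq> carrier R"
  shows "fin_rank (\<lambda>X Y. h X Y \<otimes> (c X \<otimes> u Y))"
  using assms(1)
proof induction
  case fin_rank_zero
  have "(\<lambda>X Y. \<zero> \<otimes> (c X \<otimes> u Y)) = (\<lambda>X Y. \<zero>)"
    using assms by (auto simp: fun_eq_iff image_subset_iff)
  then show ?case using fin_rank.fin_rank_zero by simp
next
  case (fin_rank_rank1 h c' u')
  have "(\<lambda>X Y. (h X Y \<oplus> c' X \<otimes> u' Y) \<otimes> (c X \<otimes> u Y))
      = (\<lambda>X Y. h X Y \<otimes> (c X \<otimes> u Y) \<oplus> (c' X \<otimes> c X) \<otimes> (u' Y \<otimes> u Y))"
    using fin_rank_rank1 assms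
    by (simp add: fun_eq_iff fin_rank_closed image_subset_iff l_distr) (simp add: m_ac)
  moreover have "fin_rank (\<lambda>X Y. h X Y \<otimes> (c X \<otimes> u Y) \<oplus> (c' X \<otimes> c X) \<otimes> (u' Y \<otimes> u Y))"
    using fin_rank_rank1 assms
    by (intro fin_rank.fin_rank_rank1[of "\<lambda>X Y. h X Y \<otimes> (c X \<otimes> u Y)" "\<lambda>X. c' X \<otimes> c X" "\<lambda>Y. u' Y \<otimes> u Y"])
      (auto simp: image_subset_iff)
  ultimately show ?case by simp
qed

text \<open>By commutativity \<open>(c X u Y) (c' X u' Y)\<close> regroups as
  \<open>(c X c' X) (u Y u' Y)\<close>, so separated terms are closed under products. With sums and
  differences this covers every polynomial in the coefficients of the linear systems.\<close>

lemma fin_rank_mult: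
  assumes "fin_rank h" "fin_rank g"
  shows "fin_rank (\<lambda>X Y. h X Y \<otimes> g X Y)"
  using assms(2)
proof induction
  case fin_rank_zero
  have "(\<lambda>X Y. h X Y \<otimes> \<zero>) = (\<lambda>X Y. \<zero>)"
    using assms(1) by (auto simp: fun_eq_iff fin_rank_closed)
  then show ?case using fin_rank.fin_rank_zero by simp
next
  case (fin_rank_rank1 g c u)
  have "(\<lambda>X Y. h X Y \<otimes> (g X Y \<oplus> c X \<otimes> u Y))
      = (\<lambda>X Y. h X Y \<otimes> g X Y \<oplus> h X Y \<otimes> (c X \<otimes> u Y))"
    using fin_rank_rank1 assms(1)
    by (auto simp: fun_eq_iff fin_rank_closed image_subset_iff r_distr)
  then show ?case
    using fin_rank_add[OF fin_rank_rank1(4) fin_rank_mult_rank1[OF assms(1) fin_rank_rank1(2,3)]]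
    by simp
qed

lemma fin_rank_diff:
  assumes "fin_rank h" "fin_rank g"
  shows "fin_rank (\<lambda>X Y. h X Y \<ominus> g X Y)"
proof -
  have "(\<lambda>X Y. h X Y \<oplus> (\<ominus> \<one>) \<otimes> g X Y) = (\<lambda>X Y. h X Y \<ominus> g X Y)"
    using assms by (auto simp: fun_eq_iff fin_rank_closed minus_eq l_minus)
  then show ?thesis
    using fin_rank_add[OF assms(1) fin_rank_mult[OF fin_rank_const assms(2)], of "\<ominus> \<one>"] by simp
qed

lemma fin_rank_swap: "fin_rank h \<Longrightarrow> fin_rank (\<lambda>X Y. h Y X)"
proof (induction rule: fin_rank.induct)
  case fin_rank_zero
  then show ?case by (rule fin_rank.fin_rank_zero)
next
  case (fin_rank_rank1 h c u)
  have "(\<lambda>X Y. h Y X \<oplus> c Y \<otimes> u X) = (\<lambda>X Y. h Y X \<oplus> u X \<otimes> c Y)"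
    using fin_rank_rank1 by (auto simp: fun_eq_iff image_subset_iff m_comm)
  then show ?case
    using fin_rank.fin_rank_rank1[OF fin_rank_rank1(4,3,2)] by simp
qed

text \<open>Infinitely many rows of a matrix of finite rank are linearly dependent. A relation among
  rows of \<open>h\<close> turns into a multiple of \<open>u\<close> once the term
  \<open>c X u Y\<close> is added; two relations with disjoint supports give two multiples of the
  same \<open>u\<close>, and a combination of them cancels it. Infinity of \<open>T\<close> supplies
  the second support.\<close>

lemma fin_rank_dependent:
  assumes "fin_rank h" "infinite T"
  shows "\<exists>F l. finite F \<and> F \<subseteq> T \<and> l \<in> F \<rightarrow> carrier R \<and> (\<exists>X\<in>F. l X \<noteq> \<zero>) \<and>
    (\<forall>Y. (\<Oplus>X\<in>F. l X \<otimes> h X Y) = \<zero>)"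
  using assms
proof (induction arbitrary: T rule: fin_rank.induct)
  case fin_rank_zero
  then obtain X where "X \<in> T" by (metis finite.emptyI ex_in_conv)
  then show ?case
    by (intro exI[of _ "{X}"] exI[of _ "\<lambda>_. \<one>"]) auto
next
  case (fin_rank_rank1 h c u)
  have h [simp]: "h X Y \<in> carrier R" for X Y
    using fin_rank_rank1(1) by (rule fin_rank_closed)
  have cu [simp]: "c X \<in> carrier R" "u X \<in> carrier R" for X
    using fin_rank_rank1 by auto
  obtain F l where F: "finite F" "F \<subseteq> T" "l \<in> F \<rightarrow> carrier R" "\<exists>X\<in>F. l X \<noteq> \<zero>"
    "\<And>Y. (\<Oplus>X\<in>F. l X \<otimes> h X Y) = \<zero>"
    using fin_rank_rank1.IH[OF fin_rank_rank1.prems] by blast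
  have "infinite (T - F)"
    using F(1) fin_rank_rank1.prems by simp
  from fin_rank_rank1.IH[OF this] obtain G m where G: "finite G" "G \<subseteq> T - F" "m \<in> G \<rightarrow> carrier R" "\<exists>X\<in>G. m X \<noteq> \<zero>"
    "\<And>Y. (\<Oplus>X\<in>G. m X \<otimes> h X Y) = \<zero>"
    by blast
  define \<alpha> \<beta> where "\<alpha> = (\<Oplus>X\<in>F. l X \<otimes> c X)" and "\<beta> = (\<Oplus>X\<in>G. m X \<otimes> c X)"
  have lc [simp]: "X \<in> F \<Longrightarrow> l X \<in> carrier R" and mc [simp]: "X \<in> G \<Longrightarrow> m X \<in> carrier R" for X
    using F(3) G(3) by auto
  have ab [simp]: "\<alpha> \<in> carrier R" "\<beta> \<in> carrier R"
    unfolding \<alpha>_def \<beta>_def by (auto intro!: finsum_closed)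
  have eval: "(\<Oplus>X\<in>F. l X \<otimes> (h X Y \<oplus> c X \<otimes> u Y)) = \<alpha> \<otimes> u Y" for Y
  proof -
    have "(\<Oplus>X\<in>F. l X \<otimes> (h X Y \<oplus> c X \<otimes> u Y))
        = (\<Oplus>X\<in>F. l X \<otimes> h X Y \<oplus> (l X \<otimes> c X) \<otimes> u Y)"
      by (rule finsum_cong') (auto simp: r_distr m_assoc)
    also have "\<dots> = (\<Oplus>X\<in>F. l X \<otimes> h X Y) \<oplus> (\<Oplus>X\<in>F. (l X \<otimes> c X) \<otimes> u Y)"
      by (rule finsum_addf) auto
    also have "(\<Oplus>X\<in>F. (l X \<otimes> c X) \<otimes> u Y) = \<alpha> \<otimes> u Y"
      unfolding \<alpha>_def using F(1) by (subst finsum_ldistr) auto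
    finally show ?thesis by (simp add: F(5))
  qed
  have evalG: "(\<Oplus>X\<in>G. m X \<otimes> (h X Y \<oplus> c X \<otimes> u Y)) = \<beta> \<otimes> u Y" for Y
  proof -
    have "(\<Oplus>X\<in>G. m X \<otimes> (h X Y \<oplus> c X \<otimes> u Y))
        = (\<Oplus>X\<in>G. m X \<otimes> h X Y \<oplus> (m X \<otimes> c X) \<otimes> u Y)"
      by (rule finsum_cong') (auto simp: r_distr m_assoc)
    also have "\<dots> = (\<Oplus>X\<in>G. m X \<otimes> h X Y) \<oplus> (\<Oplus>X\<in>G. (m X \<otimes> c X) \<otimes> u Y)"
      by (rule finsum_addf) auto
    also have "(\<Oplus>X\<in>G. (m X \<otimes> c X) \<otimes> u Y) = \<beta> \<otimes> u Y"
      unfolding \<beta>_def using G(1) by (subst finsum_ldistr) auto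
    finally show ?thesis by (simp add: G(5))
  qed
  show ?case
  proof (cases "\<alpha> = \<zero>")
    case True
    then show ?thesis
      using F by (intro exI[of _ F] exI[of _ l]) (auto simp: eval)
  next
    case False
    \<comment> \<open>The combination \<open>\<beta>\<close> times the first relation minus
      \<open>\<alpha>\<close> times the second. Since \<open>\<alpha>\<close> is nonzero and the
      supports are disjoint, a nonzero coefficient survives on \<open>G\<close>, even if
      \<open>\<beta>\<close> is zero.\<close>
    define n where "n = (\<lambda>X. if X \<in> F then \<beta> \<otimes> l X else \<ominus> (\<alpha> \<otimes> m X))"
    have n [simp]: "X \<in> F \<Longrightarrow> n X = \<beta> \<otimes> l X" "X \<in> G \<Longrightarrow> n X = \<ominus> (\<alpha> \<otimes> m X)" for X
      using G(2) by (auto simp: n_def)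
    obtain X where "X \<in> G" "m X \<noteq> \<zero>" using G(4) by blast
    then have ne: "X \<in> F \<union> G" "n X \<noteq> \<zero>"
      using False G(3) by (auto simp: integral_iff)
    have "(\<Oplus>X\<in>F \<union> G. n X \<otimes> (h X Y \<oplus> c X \<otimes> u Y)) = \<zero>" for Y
    proof -
      have "(\<Oplus>X\<in>F \<union> G. n X \<otimes> (h X Y \<oplus> c X \<otimes> u Y))
          = (\<Oplus>X\<in>F. n X \<otimes> (h X Y \<oplus> c X \<otimes> u Y)) \<oplus> (\<Oplus>X\<in>G. n X \<otimes> (h X Y \<oplus> c X \<otimes> u Y))"
        using F G by (intro finsum_Un_disjoint) auto
      also have "(\<Oplus>X\<in>F. n X \<otimes> (h X Y \<oplus> c X \<otimes> u Y))
          = (\<Oplus>X\<in>F. \<beta> \<otimes> (l X \<otimes> (h X Y \<oplus> c X \<otimes> u Y)))"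
        by (rule finsum_cong') (auto simp: m_assoc)
      also have "\<dots> = \<beta> \<otimes> (\<alpha> \<otimes> u Y)"
        using F(1) by (subst finsum_rdistr[symmetric]) (auto simp: eval)
      also have "(\<Oplus>X\<in>G. n X \<otimes> (h X Y \<oplus> c X \<otimes> u Y))
          = (\<Oplus>X\<in>G. (\<ominus> \<alpha>) \<otimes> (m X \<otimes> (h X Y \<oplus> c X \<otimes> u Y)))"
        by (rule finsum_cong') (auto simp: m_assoc l_minus)
      also have "\<dots> = (\<ominus> \<alpha>) \<otimes> (\<beta> \<otimes> u Y)"
        using G(1) by (subst finsum_rdistr[symmetric]) (auto simp: evalG)
      also have "\<beta> \<otimes> (\<alpha> \<otimes> u Y) \<oplus> (\<ominus> \<alpha>) \<otimes> (\<beta> \<otimes> u Y) = \<zero>"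
        using cu(2) ab by (simp only: l_minus m_lcomm[of \<beta> \<alpha>] m_closed r_neg)
      finally show ?thesis .
    qed
    then show ?thesis
      using F G ne by (intro exI[of _ "F \<union> G"] exI[of _ n]) (auto simp: Pi_iff)
  qed
qed

text \<open>A linear relation among the rows indexed by \<open>S\<close>, read in the column of an
  index with nonzero coefficient, leaves only a diagonal term, which cannot vanish.\<close>

lemma finite_of_fin_rank_diagonal:
  assumes "fin_rank h" "\<And>X. X \<in> S \<Longrightarrow> h X X \<noteq> \<zero>"
    "\<And>X Y. X \<in> S \<Longrightarrow> Y \<in> S \<Longrightarrow> X \<noteq> Y \<Longrightarrow> h X Y = \<zero>"
  shows "finite S"
proof (rule ccontr)
  assume "infinite S"
  from fin_rank_dependent[OF assms(1) this] obtain F l where F: "finite F" "F \<subseteq> S" "l \<in> F \<rightarrow> carrier R" "\<exists>X\<in>F. l X \<noteq> \<zero>"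
    "\<forall>Y. (\<Oplus>X\<in>F. l X \<otimes> h X Y) = \<zero>"
    by (elim exE conjE) (rule that)
  from F(4) obtain Y where Y: "Y \<in> F" "l Y \<noteq> \<zero>" by blast
  have h [simp]: "h X Y \<in> carrier R" for X Y
    using assms(1) by (rule fin_rank_closed)
  have "(\<Oplus>X\<in>F. l X \<otimes> h X Y) = (\<Oplus>X\<in>F. if Y = X then l X \<otimes> h X X else \<zero>)"
    using F(2,3) Y by (intro finsum_cong') (auto simp: assms(3) Pi_iff subset_iff)
  also have "\<dots> = l Y \<otimes> h Y Y"
    using F(1,3) Y by (intro finsum_singleton) (auto simp: Pi_iff)
  finally have "l Y \<otimes> h Y Y = \<zero>" by (simp add: F(5))
  then show False
    using Y F(2,3) assms(2)[of Y] by (auto simp: integral_iff Pi_iff subset_iff)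
qed


section \<open>Elimination for linear systems with coefficients of finite rank\<close>

text \<open>Fraction-free Gaussian elimination; the function \<open>D\<close> is the product of the pivots. Since
  the pivot row may depend on \<open>X\<close>, one passes to an infinite subset at each step.\<close>

lemma ex_fin_rank_pivot_product:
  fixes L :: "'i \<Rightarrow> 'j \<Rightarrow> 'x \<Rightarrow> 'x \<Rightarrow> 'a"
  assumes "finite J" "finite I" "infinite S"
    and "\<And>i j. i \<in> I \<Longrightarrow> j \<in> J \<Longrightarrow> fin_rank (L i j)"
    and "\<And>X y. \<lbrakk>X \<in> S; y \<in> J \<rightarrow> carrier R; \<And>i. i \<in> I \<Longrightarrow> (\<Oplus>j\<in>J. L i j X X \<otimes> y j) = \<zero>\<rbrakk>
      \<Longrightarrow> \<forall>j\<in>J. y j = \<zero>"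
  shows "\<exists>S' D. S' \<subseteq> S \<and> infinite S' \<and> fin_rank D \<and> (\<forall>X\<in>S'. D X X \<noteq> \<zero>) \<and>
    (\<forall>X\<in>S'. \<forall>Y\<in>S'. \<forall>y\<in>J \<rightarrow> carrier R. (\<forall>i\<in>I. (\<Oplus>j\<in>J. L i j X Y \<otimes> y j) = \<zero>) \<longrightarrow>
      (\<exists>j\<in>J. y j \<noteq> \<zero>) \<longrightarrow> D X Y = \<zero>)"
  using assms(1,3-)
proof (induction J arbitrary: S L rule: finite_induct)
  case empty
  then show ?case
    by (intro exI[of _ S] exI[of _ "\<lambda>_ _. \<one>"]) (auto intro: fin_rank_const)
next
  case (insert p J)
  note diag = insert.prems(3)
  have Lc [simp]: "L i j X Y \<in> carrier R" if "i \<in> I" "j = p \<or> j \<in> J" for i j X Y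
    using that insert.prems(2) by (auto intro: fin_rank_closed)
  have split: "(\<Oplus>j\<in>insert p J. L i j X Y \<otimes> y j) = L i p X Y \<otimes> y p \<oplus> (\<Oplus>j\<in>J. L i j X Y \<otimes> y j)"
    if "i \<in> I" "y \<in> insert p J \<rightarrow> carrier R" for i X Y y
    using that insert.hyps by (intro finsum_insert) (auto simp: Pi_iff)
  \<comment> \<open>If the column \<open>p\<close> vanished at \<open>(X, X)\<close>, the unit
    vector at \<open>p\<close> would be a nonzero solution of the diagonal system.\<close>
  have "\<exists>i\<in>I. L i p X X \<noteq> \<zero>" if X: "X \<in> S" for X
  proof (rule ccontr)
    assume "\<not> ?thesis"
    then have z: "\<And>i. i \<in> I \<Longrightarrow> L i p X X = \<zero>" by blast
    define y where "y = (\<lambda>j. if j = p then \<one> else \<zero>)"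
    have y: "y \<in> insert p J \<rightarrow> carrier R" by (auto simp: y_def)
    have "(\<Oplus>j\<in>insert p J. L i j X X \<otimes> y j) = \<zero>" if "i \<in> I" for i
    proof -
      have "(\<Oplus>j\<in>J. L i j X X \<otimes> y j) = (\<Oplus>j\<in>J. \<zero>)"
        using that insert.hyps by (intro finsum_cong') (auto simp: y_def)
      then show ?thesis
        using that by (subst split[OF that y]) (simp add: z y_def)
    qed
    then have "y p = \<zero>"
      using diag[OF X y] by auto
    then show False by (simp add: y_def)
  qed
  then obtain r where r: "\<And>X. X \<in> S \<Longrightarrow> r X \<in> I \<and> L (r X) p X X \<noteq> \<zero>" by metis
  have "\<exists>i\<in>I. infinite {X \<in> S. r X = i}"
    using pigeonhole_infinite_rel[OF insert.prems(1) assms(2), of "\<lambda>X i. r X = i"] r by auto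
  then obtain q where q: "q \<in> I" "infinite {X \<in> S. r X = q}" by blast
  define T where "T = {X \<in> S. r X = q}"
  have T: "T \<subseteq> S" "infinite T" and qp: "\<And>X. X \<in> T \<Longrightarrow> L q p X X \<noteq> \<zero>"
    using q r by (auto simp: T_def)
  \<comment> \<open>Cross-multiplication in place of division: pivot times row \<open>i\<close>
    minus \<open>L i p\<close> times the pivot row. Row \<open>q\<close> becomes zero and may stay
    in the system, so \<open>I\<close> does not change in the induction.\<close>
  define L' where "L' = (\<lambda>i j X Y. L q p X Y \<otimes> L i j X Y \<ominus> L i p X Y \<otimes> L q j X Y)"
  have fr: "fin_rank (L' i j)" if "i \<in> I" "j \<in> J" for i j
    unfolding L'_def using that q(1) insert.prems(2) by (intro fin_rank_diff fin_rank_mult) auto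
  have L'c [simp]: "L' i j X Y \<in> carrier R" if "i \<in> I" "j \<in> J" for i j X Y
    using fr[OF that] by (rule fin_rank_closed)
  have L'_sum: "(\<Oplus>j\<in>J. L' i j X Y \<otimes> y j)
      = L q p X Y \<otimes> (\<Oplus>j\<in>J. L i j X Y \<otimes> y j) \<ominus> L i p X Y \<otimes> (\<Oplus>j\<in>J. L q j X Y \<otimes> y j)"
    if i: "i \<in> I" and y: "y \<in> J \<rightarrow> carrier R" for i X Y y
  proof -
    have yc [simp]: "j \<in> J \<Longrightarrow> y j \<in> carrier R" for j using y by auto
    have "(\<Oplus>j\<in>J. L' i j X Y \<otimes> y j)
        = (\<Oplus>j\<in>J. L q p X Y \<otimes> (L i j X Y \<otimes> y j) \<oplus> (\<ominus> L i p X Y) \<otimes> (L q j X Y \<otimes> y j))"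
      using i q(1) by (intro finsum_cong') (auto simp: L'_def minus_eq l_distr m_assoc l_minus)
    also have "\<dots> = (\<Oplus>j\<in>J. L q p X Y \<otimes> (L i j X Y \<otimes> y j)) \<oplus> (\<Oplus>j\<in>J. (\<ominus> L i p X Y) \<otimes> (L q j X Y \<otimes> y j))"
      using i q(1) by (intro finsum_addf) auto
    also have "\<dots> = L q p X Y \<otimes> (\<Oplus>j\<in>J. L i j X Y \<otimes> y j) \<oplus> (\<ominus> L i p X Y) \<otimes> (\<Oplus>j\<in>J. L q j X Y \<otimes> y j)"
      using i q(1) insert.hyps(1) by (subst (1 2) finsum_rdistr) auto
    finally show ?thesis
      using i q(1) by (simp add: minus_eq l_minus)
  qed
  have diag': "\<forall>j\<in>J. y j = \<zero>"
    if X: "X \<in> T" and y: "y \<in> J \<rightarrow> carrier R" and sol: "\<And>i. i \<in> I \<Longrightarrow> (\<Oplus>j\<in>J. L' i j X X \<otimes> y j) = \<zero>"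
    for X y
  proof -
    define s where "s i = (\<Oplus>j\<in>J. L i j X X \<otimes> y j)" for i
    have sc [simp]: "s i \<in> carrier R" if "i \<in> I" for i
      unfolding s_def using that y by (intro finsum_closed) (auto simp: Pi_iff)
    define h where "h = L q p X X"
    have h: "h \<in> carrier R" "h \<noteq> \<zero>" and hi: "inv h \<in> carrier R" "h \<otimes> inv h = \<one>"
      using q(1) qp[OF X] by (auto simp: h_def field_Units)
    \<comment> \<open>A solution of the reduced system is extended by solving the pivot row for the
      unknown \<open>p\<close>. Dividing is harmless here, since \<open>X\<close> is fixed and
      \<open>h\<close> is a nonzero element of the field.\<close>
    define y' where "y' = y(p := \<ominus> (inv h \<otimes> s q))"
    have y': "y' \<in> insert p J \<rightarrow> carrier R"
      using y hi q(1) by (auto simp: y'_def Pi_iff)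
    have "(\<Oplus>j\<in>insert p J. L i j X X \<otimes> y' j) = \<zero>" if i: "i \<in> I" for i
    proof -
      have "(\<Oplus>j\<in>J. L i j X X \<otimes> y' j) = s i"
        unfolding s_def using y i insert.hyps by (intro finsum_cong') (auto simp: y'_def Pi_iff)
      then have e: "(\<Oplus>j\<in>insert p J. L i j X X \<otimes> y' j) = L i p X X \<otimes> (\<ominus> (inv h \<otimes> s q)) \<oplus> s i"
        by (subst split[OF i y']) (simp add: y'_def)
      have "h \<otimes> s i \<ominus> L i p X X \<otimes> s q = \<zero>"
        using sol[OF i] L'_sum[OF i y] by (simp add: h_def s_def)
      then have eq: "h \<otimes> s i = L i p X X \<otimes> s q"
        using i q(1) h by (simp add: minus_eq_zero_iff)
      have "s i = inv h \<otimes> (h \<otimes> s i)"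
        using h hi i by (simp add: m_assoc[symmetric] m_comm[of "inv h" h])
      also have "\<dots> = L i p X X \<otimes> (inv h \<otimes> s q)"
        using h hi i q(1) by (simp add: eq m_lcomm)
      finally show ?thesis
        using e h hi i q(1) by (simp add: r_minus l_neg)
    qed
    then have "\<forall>j\<in>insert p J. y' j = \<zero>"
      using diag[OF _ y'] X T(1) by blast
    then show ?thesis
      using insert.hyps(2) by (auto simp: y'_def split: if_splits)
  qed
  have "\<exists>S' D. S' \<subseteq> T \<and> infinite S' \<and> fin_rank D \<and> (\<forall>X\<in>S'. D X X \<noteq> \<zero>) \<and>
    (\<forall>X\<in>S'. \<forall>Y\<in>S'. \<forall>y\<in>J \<rightarrow> carrier R. (\<forall>i\<in>I. (\<Oplus>j\<in>J. L' i j X Y \<otimes> y j) = \<zero>) \<longrightarrow>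
      (\<exists>j\<in>J. y j \<noteq> \<zero>) \<longrightarrow> D X Y = \<zero>)"
    by (rule insert.IH[OF T(2)], erule (1) fr, rule diag', assumption+)
  then obtain S' D where D: "S' \<subseteq> T" "infinite S'" "fin_rank D" "\<forall>X\<in>S'. D X X \<noteq> \<zero>"
    and "\<forall>X\<in>S'. \<forall>Y\<in>S'. \<forall>y\<in>J \<rightarrow> carrier R. (\<forall>i\<in>I. (\<Oplus>j\<in>J. L' i j X Y \<otimes> y j) = \<zero>) \<longrightarrow>
      (\<exists>j\<in>J. y j \<noteq> \<zero>) \<longrightarrow> D X Y = \<zero>"
    by (elim exE conjE) (rule that)
  then have off: "D X Y = \<zero>" if "X \<in> S'" "Y \<in> S'" "y \<in> J \<rightarrow> carrier R"
      "\<And>i. i \<in> I \<Longrightarrow> (\<Oplus>j\<in>J. L' i j X Y \<otimes> y j) = \<zero>" "\<exists>j\<in>J. y j \<noteq> \<zero>" for X Y y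
    using that by blast
  \<comment> \<open>If the nonzero solution is nonzero somewhere on \<open>J\<close>, its
    restriction solves the reduced system and \<open>D X Y\<close> vanishes. Otherwise only
    \<open>y p\<close> is nonzero, and row \<open>q\<close> reads \<open>L q p X Y\<close> times
    \<open>y p\<close> equals zero, so the pivot itself vanishes.\<close>
  have "L q p X Y \<otimes> D X Y = \<zero>"
    if XY: "X \<in> S'" "Y \<in> S'" and y: "y \<in> insert p J \<rightarrow> carrier R"
      and sol: "\<And>i. i \<in> I \<Longrightarrow> (\<Oplus>j\<in>insert p J. L i j X Y \<otimes> y j) = \<zero>"
      and ne: "\<exists>j\<in>insert p J. y j \<noteq> \<zero>" for X Y y
  proof (cases "\<exists>j\<in>J. y j \<noteq> \<zero>")
    case True
    have yJ: "y \<in> J \<rightarrow> carrier R" and yp: "y p \<in> carrier R" using y by auto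
    define s where "s i = (\<Oplus>j\<in>J. L i j X Y \<otimes> y j)" for i
    have sc [simp]: "s i \<in> carrier R" if "i \<in> I" for i
      unfolding s_def using that yJ by (intro finsum_closed) (auto simp: Pi_iff)
    have s: "s i = \<ominus> (L i p X Y \<otimes> y p)" if i: "i \<in> I" for i
    proof -
      have "s i \<oplus> L i p X Y \<otimes> y p = \<zero>"
        using sol[OF i] split[OF i y, of X Y] i yp by (simp add: s_def[symmetric] a_comm)
      then show ?thesis
        using i yp by (metis Lc m_closed minus_equality sc)
    qed
    have "(\<Oplus>j\<in>J. L' i j X Y \<otimes> y j) = \<zero>" if i: "i \<in> I" for i
      using L'_sum[OF i yJ, of X Y] i q(1) yp s[OF i] s[OF q(1)]
      by (simp add: s_def[symmetric] r_minus m_lcomm minus_eq r_neg l_neg)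
    then have "D X Y = \<zero>"
      using off[OF XY yJ _ True] by blast
    then show ?thesis using q(1) by simp
  next
    case False
    then have yp: "y p \<noteq> \<zero>" "y p \<in> carrier R" using ne y by auto
    have "(\<Oplus>j\<in>J. L q j X Y \<otimes> y j) = (\<Oplus>j\<in>J. \<zero>)"
      using False q(1) by (intro finsum_cong') auto
    then have "L q p X Y \<otimes> y p = \<zero>"
      using sol[OF q(1)] split[OF q(1) y, of X Y] q(1) yp by simp
    then have "L q p X Y = \<zero>"
      using yp q(1) by (simp add: integral_iff)
    then show ?thesis
      using D(3) by (simp add: fin_rank_closed)
  qed
  note off_diag = this
  show ?case
  proof (intro exI conjI ballI impI)
    show "S' \<subseteq> S" using D(1) T(1) by simp
    show "infinite S'" by (rule D(2))
    show "fin_rank (\<lambda>X Y. L q p X Y \<otimes> D X Y)"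
      using insert.prems(2) q(1) D(3) by (intro fin_rank_mult) auto
    show "L q p X X \<otimes> D X X \<noteq> \<zero>" if "X \<in> S'" for X
      using that D qp q(1) by (auto simp: integral_iff fin_rank_closed)
    show "L q p X Y \<otimes> D X Y = \<zero>"
      if "X \<in> S'" "Y \<in> S'" "y \<in> insert p J \<rightarrow> carrier R"
        "\<forall>i\<in>I. (\<Oplus>j\<in>insert p J. L i j X Y \<otimes> y j) = \<zero>" "\<exists>j\<in>insert p J. y j \<noteq> \<zero>" for X Y y
      using that(4) by (intro off_diag[OF that(1-3) _ that(5)]) (rule bspec)
  qed
qed

text \<open>If \<open>S\<close> were infinite, elimination would leave an infinite part of it on
  which \<open>D X Y\<close> vanishes unless \<open>P Y X\<close>. By antisymmetry one of
  \<open>D X Y\<close> and \<open>D Y X\<close> vanishes for distinct indices, so their product is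
  diagonal there. In the application \<open>P\<close> is inclusion.\<close>

lemma finite_of_linear_systems:
  fixes L :: "'i \<Rightarrow> 'j \<Rightarrow> 'x \<Rightarrow> 'x \<Rightarrow> 'a"
  assumes "finite J" "finite I"
    and "\<And>i j. i \<in> I \<Longrightarrow> j \<in> J \<Longrightarrow> fin_rank (L i j)"
    and diag: "\<And>X y. \<lbrakk>X \<in> S; y \<in> J \<rightarrow> carrier R; \<And>i. i \<in> I \<Longrightarrow> (\<Oplus>j\<in>J. L i j X X \<otimes> y j) = \<zero>\<rbrakk>
      \<Longrightarrow> \<forall>j\<in>J. y j = \<zero>"
    and off: "\<And>X Y. \<lbrakk>X \<in> S; Y \<in> S; \<not> P Y X\<rbrakk> \<Longrightarrow>
      \<exists>y\<in>J \<rightarrow> carrier R. (\<forall>i\<in>I. (\<Oplus>j\<in>J. L i j X Y \<otimes> y j) = \<zero>) \<and> (\<exists>j\<in>J. y j \<noteq> \<zero>)"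
    and antisym: "\<And>X Y. \<lbrakk>X \<in> S; Y \<in> S; P X Y; P Y X\<rbrakk> \<Longrightarrow> X = Y"
  shows "finite S"
proof (rule ccontr)
  assume "infinite S"
  have "\<exists>S' D. S' \<subseteq> S \<and> infinite S' \<and> fin_rank D \<and> (\<forall>X\<in>S'. D X X \<noteq> \<zero>) \<and>
    (\<forall>X\<in>S'. \<forall>Y\<in>S'. \<forall>y\<in>J \<rightarrow> carrier R. (\<forall>i\<in>I. (\<Oplus>j\<in>J. L i j X Y \<otimes> y j) = \<zero>) \<longrightarrow>
      (\<exists>j\<in>J. y j \<noteq> \<zero>) \<longrightarrow> D X Y = \<zero>)"
    by (rule ex_fin_rank_pivot_product[OF assms(1,2) \<open>infinite S\<close>], erule (1) assms(3), rule diag, assumption+)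
  then obtain S' D where D: "S' \<subseteq> S" "infinite S'" "fin_rank D" "\<forall>X\<in>S'. D X X \<noteq> \<zero>"
    and D0: "\<forall>X\<in>S'. \<forall>Y\<in>S'. \<forall>y\<in>J \<rightarrow> carrier R. (\<forall>i\<in>I. (\<Oplus>j\<in>J. L i j X Y \<otimes> y j) = \<zero>) \<longrightarrow>
      (\<exists>j\<in>J. y j \<noteq> \<zero>) \<longrightarrow> D X Y = \<zero>"
    by (elim exE conjE) (rule that)
  have "fin_rank (\<lambda>X Y. D X Y \<otimes> D Y X)"
    by (intro fin_rank_mult D(3) fin_rank_swap)
  moreover have "D X X \<otimes> D X X \<noteq> \<zero>" if "X \<in> S'" for X
    using that D by (auto simp: integral_iff fin_rank_closed)
  moreover have "D X Y \<otimes> D Y X = \<zero>" if XY: "X \<in> S'" "Y \<in> S'" "X \<noteq> Y" for X Y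
  proof -
    have c: "D X Y \<in> carrier R" "D Y X \<in> carrier R"
      using D(3) by (auto intro: fin_rank_closed)
    have *: "D U W = \<zero>" if "U \<in> S'" "W \<in> S'" "\<not> P W U" for U W
      using off[of U W] D0 that D(1) by blast
    from XY antisym D(1) have "\<not> P X Y \<or> \<not> P Y X" by blast
    then show ?thesis using * XY c by auto
  qed
  ultimately have "finite S'"
    by (rule finite_of_fin_rank_diagonal)
  with D(2) show False by simp
qed

end


section \<open>Complements of subspaces\<close>

lemma (in abelian_group) additive_finsum:
  assumes "abelian_group H" and f: "f \<in> carrier G \<rightarrow> carrier H"
    and add: "\<And>x y. x \<in> carrier G \<Longrightarrow> y \<in> carrier G \<Longrightarrow> f (x \<oplus> y) = f x \<oplus>\<^bsub>H\<^esub> f y"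
    and "finite A" "g \<in> A \<rightarrow> carrier G"
  shows "f (\<Oplus>i\<in>A. g i) = (\<Oplus>\<^bsub>H\<^esub>i\<in>A. f (g i))"
proof -
  interpret H: abelian_group H by fact
  have fc [simp]: "x \<in> carrier G \<Longrightarrow> f x \<in> carrier H" for x using f by auto
  have "f \<zero> \<oplus>\<^bsub>H\<^esub> f \<zero> = f \<zero>"
    using add[of \<zero> \<zero>] by simp
  then have z: "f \<zero> = \<zero>\<^bsub>H\<^esub>"
    by (metis H.add.r_cancel_one' fc zero_closed)
  show ?thesis
    using assms(4,5) by (induction) (auto simp: z add Pi_iff)
qed

locale vspace = K: field K + V: module K V for K and V (structure)
begin

definition lfun :: "('c \<Rightarrow> 'a) \<Rightarrow> bool" where
  "lfun k \<longleftrightarrow> k \<in> carrier V \<rightarrow> carrier K \<and>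
     (\<forall>x\<in>carrier V. \<forall>y\<in>carrier V. k (x \<oplus> y) = k x \<oplus>\<^bsub>K\<^esub> k y) \<and>
     (\<forall>c\<in>carrier K. \<forall>x\<in>carrier V. k (c \<odot> x) = c \<otimes>\<^bsub>K\<^esub> k x)"

text \<open>Values off the carrier are unconstrained, in contrast to \<open>rmod_hom\<close>, so
  that these maps compose as plain functions.\<close>

definition lmap :: "('c \<Rightarrow> 'c) \<Rightarrow> bool" where
  "lmap f \<longleftrightarrow> f \<in> carrier V \<rightarrow> carrier V \<and>
     (\<forall>x\<in>carrier V. \<forall>y\<in>carrier V. f (x \<oplus> y) = f x \<oplus> f y) \<and>
     (\<forall>c\<in>carrier K. \<forall>x\<in>carrier V. f (c \<odot> x) = c \<odot> f x)"

lemma lfun_closed [simp]: "lfun k \<Longrightarrow> x \<in> carrier V \<Longrightarrow> k x \<in> carrier K"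
  and lfun_add: "lfun k \<Longrightarrow> x \<in> carrier V \<Longrightarrow> y \<in> carrier V \<Longrightarrow> k (x \<oplus> y) = k x \<oplus>\<^bsub>K\<^esub> k y"
  and lfun_smult: "lfun k \<Longrightarrow> c \<in> carrier K \<Longrightarrow> x \<in> carrier V \<Longrightarrow> k (c \<odot> x) = c \<otimes>\<^bsub>K\<^esub> k x"
  by (auto simp: lfun_def)

lemma lmap_closed [simp]: "lmap f \<Longrightarrow> x \<in> carrier V \<Longrightarrow> f x \<in> carrier V"
  and lmap_add: "lmap f \<Longrightarrow> x \<in> carrier V \<Longrightarrow> y \<in> carrier V \<Longrightarrow> f (x \<oplus> y) = f x \<oplus> f y"
  and lmap_smult: "lmap f \<Longrightarrow> c \<in> carrier K \<Longrightarrow> x \<in> carrier V \<Longrightarrow> f (c \<odot> x) = c \<odot> f x"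
  by (auto simp: lmap_def)

lemma lmap_diff:
  assumes "lmap f" "x \<in> carrier V" "y \<in> carrier V"
  shows "f (x \<ominus> y) = f x \<ominus> f y"
proof -
  have "f (x \<ominus> y) \<oplus> f y = f x"
    using assms by (simp add: lmap_add[symmetric] V.minus_eq V.a_assoc V.l_neg)
  then show ?thesis
    using assms by (metis V.add.inv_solve_right V.minus_closed V.minus_eq lmap_closed)
qed

lemma lmap_finsum:
  assumes "lmap f" "finite A" "g \<in> A \<rightarrow> carrier V"
  shows "f (\<Oplus>i\<in>A. g i) = (\<Oplus>i\<in>A. f (g i))"
  using assms by (intro V.additive_finsum V.abelian_group_axioms) (auto simp: lmap_add)

lemma lfun_finsum:
  assumes "lfun k" "finite A" "g \<in> A \<rightarrow> carrier V"
  shows "k (\<Oplus>i\<in>A. g i) = (\<Oplus>\<^bsub>K\<^esub>i\<in>A. k (g i))"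
  using assms by (intro V.additive_finsum K.abelian_group_axioms) (auto simp: lfun_add)

lemma lmap_compose: "lmap f \<Longrightarrow> lmap g \<Longrightarrow> lmap (\<lambda>x. f (g x))"
  by (auto simp: lmap_def Pi_iff)

lemma lfun_lmap: "lfun k \<Longrightarrow> lmap g \<Longrightarrow> lfun (\<lambda>x. k (g x))"
  by (auto simp: lmap_def lfun_def Pi_iff)

abbreviation comb :: "'c set \<Rightarrow> ('c \<Rightarrow> 'a) \<Rightarrow> 'c" where
  "comb B d \<equiv> (\<Oplus>b\<in>B. d b \<odot> b)"

lemma comb_closed:
  "B \<subseteq> carrier V \<Longrightarrow> d \<in> B \<rightarrow> carrier K \<Longrightarrow> comb B d \<in> carrier V"
  by (intro V.finsum_closed) (auto simp: Pi_iff subset_iff)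

lemma comb_add:
  assumes "B \<subseteq> carrier V" "d \<in> B \<rightarrow> carrier K" "d' \<in> B \<rightarrow> carrier K"
  shows "comb B (\<lambda>b. d b \<oplus>\<^bsub>K\<^esub> d' b) = comb B d \<oplus> comb B d'"
proof -
  have "comb B (\<lambda>b. d b \<oplus>\<^bsub>K\<^esub> d' b) = (\<Oplus>b\<in>B. d b \<odot> b \<oplus> d' b \<odot> b)"
    using assms by (intro V.finsum_cong') (auto simp: V.smult_l_distr Pi_iff subset_iff)
  also have "\<dots> = comb B d \<oplus> comb B d'"
    using assms by (intro V.finsum_addf) (auto simp: Pi_iff subset_iff)
  finally show ?thesis .
qed

lemma comb_smult:
  assumes "finite B" "B \<subseteq> carrier V" "d \<in> B \<rightarrow> carrier K" "c \<in> carrier K"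
  shows "comb B (\<lambda>b. c \<otimes>\<^bsub>K\<^esub> d b) = c \<odot> comb B d"
proof -
  have "comb B (\<lambda>b. c \<otimes>\<^bsub>K\<^esub> d b) = (\<Oplus>b\<in>B. c \<odot> (d b \<odot> b))"
    using assms by (intro V.finsum_cong') (auto simp: V.smult_assoc1 Pi_iff subset_iff)
  also have "\<dots> = c \<odot> comb B d"
    using assms by (intro V.finsum_smult_ldistr[symmetric]) (auto simp: Pi_iff subset_iff)
  finally show ?thesis .
qed

text \<open>\<open>B\<close> is a maximal subset of the spanning set that is independent modulo
  \<open>N\<close>, hence a basis modulo \<open>N\<close>, and \<open>k b v\<close> is the
  coordinate of \<open>v\<close> at \<open>b\<close>. This single statement yields both projections
  onto \<open>N\<close> and, for \<open>N\<close> zero, coordinates on the whole space.\<close>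

lemma ex_complement_coordinates:
  assumes S: "finite S" "S \<subseteq> carrier V"
    and span: "\<forall>v\<in>carrier V. \<exists>c\<in>S \<rightarrow> carrier K. v = comb S c"
    and N: "submodule N K V"
  shows "\<exists>B k. B \<subseteq> S \<and> (\<forall>b\<in>B. lfun (k b)) \<and> (\<forall>v\<in>carrier V. v \<ominus> comb B (\<lambda>b. k b v) \<in> N) \<and>
    (\<forall>v\<in>N. \<forall>b\<in>B. k b v = \<zero>\<^bsub>K\<^esub>)"
proof -
  note NE = V.submoduleE[OF N]
  have N0: "\<zero> \<in> N" using NE(2,3,5) NE(1) by (metis V.r_neg equals0I subsetD)
  define indep where "indep B \<longleftrightarrow>
    (\<forall>c\<in>B \<rightarrow> carrier K. comb B c \<in> N \<longrightarrow> (\<forall>b\<in>B. c b = \<zero>\<^bsub>K\<^esub>))" for B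
  define I where "I = {B. B \<subseteq> S \<and> indep B}"
  have "finite I" using S(1) by (simp add: I_def)
  moreover have "{} \<in> I" by (simp add: I_def indep_def)
  ultimately have "\<exists>B\<in>I. \<forall>B'\<in>I. B \<subseteq> B' \<longrightarrow> B = B'"
    by (intro finite_has_maximal) auto
  then obtain B where "B \<in> I" "\<forall>B'\<in>I. B \<subseteq> B' \<longrightarrow> B = B'"
    by (elim bexE) (rule that)
  then have B: "B \<subseteq> S" "indep B"
    and max: "\<And>B'. B' \<subseteq> S \<Longrightarrow> indep B' \<Longrightarrow> B \<subseteq> B' \<Longrightarrow> B = B'"
    by (simp_all add: I_def)
  have indepD: "c b = \<zero>\<^bsub>K\<^esub>" if "c \<in> B \<rightarrow> carrier K" "comb B c \<in> N" "b \<in> B" for c b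
    using B(2) that by (simp add: indep_def)
  have finB: "finite B" and BV: "B \<subseteq> carrier V"
    using B(1) S finite_subset by auto
  note combc = comb_closed[OF BV]
  \<comment> \<open>\<open>d\<close> is a coordinate vector of \<open>v\<close> modulo
    \<open>N\<close>. It is unique on \<open>B\<close> by independence, which will make the chosen
    coordinates linear.\<close>
  define rep where "rep v d \<longleftrightarrow> d \<in> B \<rightarrow> carrier K \<and> v \<ominus> comb B d \<in> N" for v d
  have rep_add: "rep (v \<oplus> w) (\<lambda>b. d b \<oplus>\<^bsub>K\<^esub> e b)"
    if "rep v d" "rep w e" "v \<in> carrier V" "w \<in> carrier V" for v w d e
  proof -
    have de: "d \<in> B \<rightarrow> carrier K" "e \<in> B \<rightarrow> carrier K" using that by (auto simp: rep_def)
    have "v \<oplus> w \<ominus> comb B (\<lambda>b. d b \<oplus>\<^bsub>K\<^esub> e b) = (v \<ominus> comb B d) \<oplus> (w \<ominus> comb B e)"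
      using that(3,4) combc[OF de(1)] combc[OF de(2)]
      by (simp add: comb_add[OF BV de] V.minus_eq V.minus_add V.a_ac)
    moreover have "(v \<ominus> comb B d) \<oplus> (w \<ominus> comb B e) \<in> N"
      using that NE(5) by (auto simp: rep_def)
    ultimately show ?thesis using de by (auto simp: rep_def Pi_iff)
  qed
  have rep_smult: "rep (c \<odot> v) (\<lambda>b. c \<otimes>\<^bsub>K\<^esub> d b)"
    if "rep v d" "v \<in> carrier V" "c \<in> carrier K" for v c d
  proof -
    have d: "d \<in> B \<rightarrow> carrier K" using that by (auto simp: rep_def)
    have "c \<odot> v \<ominus> comb B (\<lambda>b. c \<otimes>\<^bsub>K\<^esub> d b) = c \<odot> (v \<ominus> comb B d)"
      using that(2,3) combc[OF d]
      by (simp add: comb_smult[OF finB BV d that(3)] V.minus_eq V.smult_r_distr V.smult_r_minus)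
    moreover have "c \<odot> (v \<ominus> comb B d) \<in> N"
      using that NE(4) by (auto simp: rep_def)
    ultimately show ?thesis using d that(3) by (auto simp: rep_def Pi_iff)
  qed
  have rep_zero: "rep v (\<lambda>b. \<zero>\<^bsub>K\<^esub>)" if "v \<in> N" for v
  proof -
    have "comb B (\<lambda>b. \<zero>\<^bsub>K\<^esub>) = (\<Oplus>b\<in>B. \<zero>)"
      using BV by (intro V.finsum_cong') auto
    then show ?thesis using that NE(1) by (auto simp: rep_def subset_iff)
  qed
  have rep_unique: "d b = e b" if de: "rep v d" "rep v e" and v: "v \<in> carrier V" and b: "b \<in> B" for v d e b
  proof -
    have dc: "d \<in> B \<rightarrow> carrier K" and ec: "e \<in> B \<rightarrow> carrier K" using de by (auto simp: rep_def)
    have "rep (\<ominus>\<^bsub>K\<^esub> \<one>\<^bsub>K\<^esub> \<odot> v) (\<lambda>b. \<ominus>\<^bsub>K\<^esub> \<one>\<^bsub>K\<^esub> \<otimes>\<^bsub>K\<^esub> e b)"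
      using rep_smult[OF de(2) v] by simp
    from rep_add[OF de(1) this v] v
    have r: "rep \<zero> (\<lambda>b. d b \<oplus>\<^bsub>K\<^esub> \<ominus>\<^bsub>K\<^esub> \<one>\<^bsub>K\<^esub> \<otimes>\<^bsub>K\<^esub> e b)" (is "rep _ ?g")
      by (simp add: V.smult_l_minus V.r_neg)
    then have g: "?g \<in> B \<rightarrow> carrier K" "\<zero> \<ominus> comb B ?g \<in> N" by (auto simp: rep_def)
    then have "comb B ?g \<in> N"
      using NE(3)[OF g(2)] combc[OF g(1)] by (simp add: V.minus_eq)
    then have "?g b = \<zero>\<^bsub>K\<^esub>" using indepD[OF g(1) _ b] by simp
    then show ?thesis
      using dc ec b by (auto simp: K.l_minus K.minus_eq[symmetric] K.minus_eq_zero_iff Pi_iff)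
  qed
  have rep_ex_S: "\<exists>d. rep s d" if s: "s \<in> S" for s
  proof (cases "s \<in> B")
    case True
    define d where "d = (\<lambda>b. if s = b then \<one>\<^bsub>K\<^esub> else \<zero>\<^bsub>K\<^esub>)"
    have "comb B d = (\<Oplus>b\<in>B. if s = b then b else \<zero>)"
      using BV by (intro V.finsum_cong') (auto simp: d_def)
    also have "\<dots> = s"
      using True finB BV by (intro V.finsum_singleton) auto
    finally have "rep s d"
      using True BV N0 by (auto simp: rep_def d_def V.minus_eq V.r_neg)
    then show ?thesis by (rule exI[of "rep s"])
  next
    case False
    have sV: "s \<in> carrier V" using s S(2) by auto
    \<comment> \<open>Maximality gives a relation modulo \<open>N\<close> that involves
      \<open>s\<close>; its coefficient at \<open>s\<close> is nonzero because \<open>B\<close> is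
      independent, so the relation can be solved for \<open>s\<close>.\<close>
    have "\<not> indep (insert s B)"
      using max[of "insert s B"] B(1) s False by blast
    then obtain c where c: "c \<in> insert s B \<rightarrow> carrier K" "comb (insert s B) c \<in> N"
      and ne: "\<exists>b\<in>insert s B. c b \<noteq> \<zero>\<^bsub>K\<^esub>"
      unfolding indep_def by blast
    have cB: "c \<in> B \<rightarrow> carrier K" and cs: "c s \<in> carrier K" using c(1) by auto
    have ins: "comb (insert s B) c = c s \<odot> s \<oplus> comb B c"
      using False finB BV cB cs sV by (intro V.finsum_insert) (auto simp: Pi_iff subset_iff)
    have cs0: "c s \<noteq> \<zero>\<^bsub>K\<^esub>"
    proof
      assume z: "c s = \<zero>\<^bsub>K\<^esub>"
      then have "comb B c \<in> N" using c(2) ins combc[OF cB] sV by simp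
      then have "\<forall>b\<in>B. c b = \<zero>\<^bsub>K\<^esub>" using indepD[OF cB] by blast
      then show False using ne z by auto
    qed
    define i where "i = inv\<^bsub>K\<^esub> (c s)"
    have i: "i \<in> carrier K" "i \<otimes>\<^bsub>K\<^esub> c s = \<one>\<^bsub>K\<^esub>"
      using cs cs0 by (auto simp: i_def K.field_Units)
    have "s \<ominus> comb B (\<lambda>b. (\<ominus>\<^bsub>K\<^esub> i) \<otimes>\<^bsub>K\<^esub> c b) = i \<odot> (c s \<odot> s \<oplus> comb B c)"
      using i cs sV combc[OF cB]
      by (simp add: comb_smult[OF finB BV cB] V.smult_r_distr V.smult_assoc1[symmetric]
          V.smult_l_minus V.minus_eq)
    also have "\<dots> \<in> N"
      using NE(4)[OF i(1) c(2)] ins by simp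
    finally have "rep s (\<lambda>b. (\<ominus>\<^bsub>K\<^esub> i) \<otimes>\<^bsub>K\<^esub> c b)"
      using i cB by (auto simp: rep_def Pi_iff)
    then show ?thesis by (rule exI[of "rep s"])
  qed
  have rep_ex: "\<exists>d. rep v d" if v: "v \<in> carrier V" for v
  proof -
    obtain c where c: "c \<in> S \<rightarrow> carrier K" "v = comb S c" using bspec[OF span v] by blast
    have "\<exists>d. rep (comb F c) d" if "finite F" "F \<subseteq> S" for F
      using that
    proof induction
      case empty
      then show ?case using rep_zero[OF N0] by auto
    next
      case (insert s F)
      then obtain d e where de: "rep (comb F c) d" "rep s e" using rep_ex_S[of s] by auto
      have sc: "s \<in> carrier V" "c s \<in> carrier K" "F \<subseteq> carrier V" "c \<in> F \<rightarrow> carrier K"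
        using insert.prems S(2) c(1) by auto
      have "comb (insert s F) c = c s \<odot> s \<oplus> comb F c"
        using insert.hyps sc by (intro V.finsum_insert) (auto simp: Pi_iff subset_iff)
      then show ?case
        using rep_add[OF rep_smult[OF de(2) sc(1,2)] de(1)] sc comb_closed[OF sc(3,4)] by auto
    qed
    from this[OF S(1)] show ?thesis by (simp add: c(2))
  qed
  define k where "k b v = (SOME d. rep v d) b" for b v
  have k: "rep v (\<lambda>b. k b v)" if "v \<in> carrier V" for v
    using someI_ex[OF rep_ex[OF that]] by (simp add: k_def)
  have k_eq: "k b v = d b" if "rep v d" "v \<in> carrier V" "b \<in> B" for b v d
    using rep_unique[OF k that(1)] that by blast
  have "lfun (k b)" if b: "b \<in> B" for b
    unfolding lfun_def
  proof (intro conjI ballI)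
    show "k b \<in> carrier V \<rightarrow> carrier K"
      using k b by (auto simp: rep_def Pi_iff)
    show "k b (x \<oplus> y) = k b x \<oplus>\<^bsub>K\<^esub> k b y" if "x \<in> carrier V" "y \<in> carrier V" for x y
      using k_eq[OF rep_add[OF k k]] that b by simp
    show "k b (c \<odot> x) = c \<otimes>\<^bsub>K\<^esub> k b x" if "c \<in> carrier K" "x \<in> carrier V" for c x
      using k_eq[OF rep_smult[OF k]] that b by simp
  qed
  moreover have "v \<ominus> comb B (\<lambda>b. k b v) \<in> N" if "v \<in> carrier V" for v
    using k[OF that] by (simp add: rep_def)
  moreover have "k b v = \<zero>\<^bsub>K\<^esub>" if "v \<in> N" "b \<in> B" for b v
    using k_eq[OF rep_zero] that NE(1) by auto
  ultimately show ?thesis using B(1) by blast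
qed

lemma lmap_diff_comb:
  assumes "finite B" "B \<subseteq> carrier V" "\<And>b. b \<in> B \<Longrightarrow> lfun (k b)"
  shows "lmap (\<lambda>v. v \<ominus> comb B (\<lambda>b. k b v))"
proof -
  have kc: "(\<lambda>b. k b v) \<in> B \<rightarrow> carrier K" if "v \<in> carrier V" for v
    using that assms by auto
  have add: "comb B (\<lambda>b. k b (v \<oplus> w)) = comb B (\<lambda>b. k b v) \<oplus> comb B (\<lambda>b. k b w)"
    if "v \<in> carrier V" "w \<in> carrier V" for v w
    unfolding comb_add[OF assms(2) kc[OF that(1)] kc[OF that(2)], symmetric]
    using that assms by (intro V.finsum_cong') (auto simp: lfun_add subset_iff)
  have smult: "comb B (\<lambda>b. k b (c \<odot> v)) = c \<odot> comb B (\<lambda>b. k b v)"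
    if "v \<in> carrier V" "c \<in> carrier K" for v c
    unfolding comb_smult[OF assms(1,2) kc[OF that(1)] that(2), symmetric]
    using that assms by (intro V.finsum_cong') (auto simp: lfun_smult subset_iff)
  show ?thesis
    unfolding lmap_def using comb_closed[OF assms(2) kc]
    by (auto simp: add smult V.minus_eq V.minus_add V.a_ac V.smult_r_distr V.smult_r_minus)
qed

text \<open>Subtracting the component along the complement leaves the component in \<open>N\<close>;
  on \<open>N\<close> the complementary coordinates are zero.\<close>

lemma ex_projection:
  assumes "finite S" "S \<subseteq> carrier V"
    and "\<forall>v\<in>carrier V. \<exists>c\<in>S \<rightarrow> carrier K. v = comb S c"
    and "submodule N K V"
  shows "\<exists>p. lmap p \<and> (\<forall>v\<in>carrier V. p v \<in> N) \<and> (\<forall>v\<in>N. p v = v)"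
proof -
  from ex_complement_coordinates[OF assms]
  obtain B k where B: "B \<subseteq> S" "\<forall>b\<in>B. lfun (k b)" "\<forall>v\<in>carrier V. v \<ominus> comb B (\<lambda>b. k b v) \<in> N"
    "\<forall>v\<in>N. \<forall>b\<in>B. k b v = \<zero>\<^bsub>K\<^esub>"
    by (elim exE conjE) (rule that)
  have fB: "finite B" "B \<subseteq> carrier V" using B(1) assms finite_subset by auto
  show ?thesis
  proof (intro exI conjI ballI)
    show "lmap (\<lambda>v. v \<ominus> comb B (\<lambda>b. k b v))"
      using B(2) fB by (intro lmap_diff_comb) auto
    show "v \<ominus> comb B (\<lambda>b. k b v) \<in> N" if "v \<in> carrier V" for v
      using B(3) that by blast
    show "v \<ominus> comb B (\<lambda>b. k b v) = v" if v: "v \<in> N" for v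
    proof -
      have "comb B (\<lambda>b. k b v) = (\<Oplus>b\<in>B. \<zero>)"
        using B(4) fB v by (intro V.finsum_cong') auto
      then show ?thesis
        using v V.submoduleE(1)[OF assms(4)] by (auto simp: subset_iff)
    qed
  qed
qed

lemma ex_frame:
  assumes "finite S" "S \<subseteq> carrier V"
    and "\<forall>v\<in>carrier V. \<exists>c\<in>S \<rightarrow> carrier K. v = comb S c"
  shows "\<exists>E k. finite E \<and> E \<subseteq> carrier V \<and> (\<forall>e\<in>E. lfun (k e)) \<and>
    (\<forall>v\<in>carrier V. v = comb E (\<lambda>e. k e v))"
proof -
  have "submodule {\<zero>} K V"
    by (rule V.submoduleI) auto
  from ex_complement_coordinates[OF assms this] obtain E k where
    E: "E \<subseteq> S" "\<forall>b\<in>E. lfun (k b)" "\<forall>v\<in>carrier V. v \<ominus> comb E (\<lambda>b. k b v) \<in> {\<zero>}"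
    by (elim exE conjE) (rule that)
  have fE: "finite E" "E \<subseteq> carrier V" using E(1) assms finite_subset by auto
  have "v = comb E (\<lambda>e. k e v)" if v: "v \<in> carrier V" for v
  proof -
    have "comb E (\<lambda>e. k e v) \<in> carrier V"
      using E(2) v by (intro comb_closed[OF fE(2)]) auto
    then show ?thesis
      using E(3) v by (auto simp: V.minus_eq_zero_iff)
  qed
  then show ?thesis using E(2) fE by blast
qed

end


section \<open>Finiteness of families of rigid invariant subspaces\<close>

lemma (in abelian_monoid) finsum_Times:
  assumes "finite A" "finite B" "f \<in> A \<times> B \<rightarrow> carrier G"
  shows "(\<Oplus>p\<in>A \<times> B. f p) = (\<Oplus>a\<in>A. \<Oplus>b\<in>B. f (a, b))"
  using assms(1,3)
proof induction
  case empty
  then show ?case by simp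
next
  case (insert a A)
  have "(\<Oplus>p\<in>insert a A \<times> B. f p) = (\<Oplus>p\<in>Pair a ` B \<union> A \<times> B. f p)"
    by (rule arg_cong[where f = "finsum G f"]) auto
  also have "\<dots> = (\<Oplus>p\<in>Pair a ` B. f p) \<oplus> (\<Oplus>p\<in>A \<times> B. f p)"
    using insert assms(2) by (intro finsum_Un_disjoint) auto
  also have "(\<Oplus>p\<in>Pair a ` B. f p) = (\<Oplus>b\<in>B. f (a, b))"
    using insert.prems by (intro finsum_reindex) (auto simp: inj_on_def)
  also have "(\<Oplus>p\<in>A \<times> B. f p) = (\<Oplus>a\<in>A. \<Oplus>b\<in>B. f (a, b))"
    using insert.prems by (intro insert.IH) auto
  also have "(\<Oplus>b\<in>B. f (a, b)) \<oplus> (\<Oplus>a\<in>A. \<Oplus>b\<in>B. f (a, b)) = (\<Oplus>a\<in>insert a A. \<Oplus>b\<in>B. f (a, b))"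
    using insert by (intro finsum_insert[symmetric]) (auto intro!: finsum_closed)
  finally show ?case .
qed

context vspace
begin

text \<open>In the application \<open>Ts\<close> consists of the actions of finitely many algebra elements, and the
  hypothesis \<open>rigid\<close> says that every homomorphism from \<open>N\<close> to \<open>V / N\<close> vanishes. Geometrically, \<open>N\<close>
  is a point of the variety of invariant subspaces with vanishing tangent space, hence isolated.
  With \<open>p N\<close> a projection onto \<open>N\<close> and \<open>q N\<close> the complementary projection, the linear system for
  \<open>f \<in> End V\<close> attached to the pair \<open>(X, Y)\<close> is \<open>f = q X f p Y\<close>, \<open>q X f T p Y = q X T f p Y\<close>.
  For \<open>X = Y\<close> its only solution is \<open>0\<close>, while in general \<open>q X p Y\<close> is a solution, which is
  nonzero unless \<open>Y \<subseteq> X\<close>.\<close>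

lemma finite_rigid_subspaces:
  assumes S: "finite S" "S \<subseteq> carrier V"
    and span: "\<forall>v\<in>carrier V. \<exists>c\<in>S \<rightarrow> carrier K. v = comb S c"
    and Ts: "finite Ts" "\<And>T. T \<in> Ts \<Longrightarrow> lmap T"
    and sub: "\<And>N. N \<in> \<N> \<Longrightarrow> submodule N K V"
    and inv: "\<And>N T n. N \<in> \<N> \<Longrightarrow> T \<in> Ts \<Longrightarrow> n \<in> N \<Longrightarrow> T n \<in> N"
    and rigid: "\<And>N f n. \<lbrakk>N \<in> \<N>; lmap f; \<And>T n. T \<in> Ts \<Longrightarrow> n \<in> N \<Longrightarrow> f (T n) \<ominus> T (f n) \<in> N; n \<in> N\<rbrakk>
      \<Longrightarrow> f n \<in> N"
  shows "finite \<N>"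
proof -
  obtain E k where E: "finite E" "E \<subseteq> carrier V" and k: "\<forall>e\<in>E. lfun (k e)"
    and frame: "\<forall>v\<in>carrier V. v = comb E (\<lambda>e. k e v)"
    using ex_frame[OF S span] by (elim exE conjE) (rule that)
  have k [simp]: "e \<in> E \<Longrightarrow> lfun (k e)" for e using k by blast
  have Ec [simp]: "e \<in> E \<Longrightarrow> e \<in> carrier V" for e using E by blast
  have frame0: "v = \<zero>" if "v \<in> carrier V" "\<And>d. d \<in> E \<Longrightarrow> k d v = \<zero>\<^bsub>K\<^esub>" for v
  proof -
    have "comb E (\<lambda>e. k e v) = (\<Oplus>e\<in>E. \<zero>)"
      using that by (intro V.finsum_cong') auto
    then show ?thesis using frame that(1) by simp
  qed
  \<comment> \<open>The index type consists of all sets, so \<open>p\<close> also needs a value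
    outside the family; the zero map keeps every coefficient of the system in the field.\<close>
  have "\<exists>p. lmap p \<and> (N \<in> \<N> \<longrightarrow> (\<forall>v\<in>carrier V. p v \<in> N) \<and> (\<forall>v\<in>N. p v = v))" for N
  proof (cases "N \<in> \<N>")
    case True
    then show ?thesis using ex_projection[OF S span sub] by blast
  next
    case False
    have "lmap (\<lambda>v. \<zero>)" by (auto simp: lmap_def)
    then show ?thesis using False by blast
  qed
  then obtain p where p [simp]: "\<And>N. lmap (p N)"
    and pN: "\<And>N v. N \<in> \<N> \<Longrightarrow> v \<in> carrier V \<Longrightarrow> p N v \<in> N"
    and pid: "\<And>N v. N \<in> \<N> \<Longrightarrow> v \<in> N \<Longrightarrow> p N v = v"
    by metis
  have NV: "n \<in> carrier V" if "N \<in> \<N>" "n \<in> N" for N n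
    using V.submoduleE(1)[OF sub[OF that(1)]] that(2) by blast
  define q where "q N v = v \<ominus> p N v" for N v
  have q [simp]: "lmap (q N)" for N
    unfolding q_def lmap_def
    by (auto simp: lmap_add lmap_smult V.minus_eq V.minus_add V.a_ac V.smult_r_distr V.smult_r_minus)
  have q0: "q N n = \<zero>" if "N \<in> \<N>" "n \<in> N" for N n
    using that NV by (simp add: q_def pid V.minus_eq V.r_neg)
  have qN: "v \<in> N" if "N \<in> \<N>" "v \<in> carrier V" "q N v = \<zero>" for N v
    using that pN[OF that(1,2)] by (simp add: q_def V.minus_eq_zero_iff)
  have qq: "q N (q N v) = q N v" if "N \<in> \<N>" "v \<in> carrier V" for N v
    using that q0[OF that(1) pN[OF that]]
    by (subst (2) q_def) (simp add: lmap_diff)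
  define J where "J = E \<times> E"
  have J: "finite J" using E by (simp add: J_def)
  have Jc [simp]: "j \<in> J \<Longrightarrow> fst j \<in> E" "j \<in> J \<Longrightarrow> snd j \<in> E" for j
    by (auto simp: J_def)
  \<comment> \<open>The endomorphism with matrix \<open>y\<close>: the entry \<open>y (e, d)\<close>
    is the contribution of the coordinate \<open>e\<close> of the argument to the coordinate
    \<open>d\<close> of the value.\<close>
  define op where "op y v = (\<Oplus>j\<in>J. (k (fst j) v \<otimes>\<^bsub>K\<^esub> y j) \<odot> snd j)" for y v
  have op_lmap: "lmap (op y)" if y: "y \<in> J \<rightarrow> carrier K" for y
  proof -
    have yc [simp]: "j \<in> J \<Longrightarrow> y j \<in> carrier K" for j using y by auto
    show ?thesis
      unfolding lmap_def
    proof (intro conjI ballI)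
      show "op y \<in> carrier V \<rightarrow> carrier V"
        unfolding op_def by (intro Pi_I V.finsum_closed; simp)
      fix v assume v: "v \<in> carrier V"
      show "op y (v \<oplus> w) = op y v \<oplus> op y w" if w: "w \<in> carrier V" for w
      proof -
        have "op y (v \<oplus> w) = (\<Oplus>j\<in>J. (k (fst j) v \<otimes>\<^bsub>K\<^esub> y j) \<odot> snd j \<oplus> (k (fst j) w \<otimes>\<^bsub>K\<^esub> y j) \<odot> snd j)"
          unfolding op_def using v w
          by (intro V.finsum_cong' refl Pi_I; simp add: lfun_add K.l_distr V.smult_l_distr)
        also have "\<dots> = op y v \<oplus> op y w"
          unfolding op_def using v w by (intro V.finsum_addf Pi_I; simp)
        finally show ?thesis .
      qed
      show "op y (c \<odot> v) = c \<odot> op y v" if c: "c \<in> carrier K" for c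
      proof -
        have "op y (c \<odot> v) = (\<Oplus>j\<in>J. c \<odot> ((k (fst j) v \<otimes>\<^bsub>K\<^esub> y j) \<odot> snd j))"
          unfolding op_def using v c
          by (intro V.finsum_cong' refl Pi_I; simp add: lfun_smult K.m_assoc V.smult_assoc1)
        also have "\<dots> = c \<odot> op y v"
          unfolding op_def using v c J by (intro V.finsum_smult_ldistr[symmetric] Pi_I; simp)
        finally show ?thesis .
      qed
    qed
  qed
  have op_eval: "f (op y v) = (\<Oplus>\<^bsub>K\<^esub>j\<in>J. (k (fst j) v \<otimes>\<^bsub>K\<^esub> f (snd j)) \<otimes>\<^bsub>K\<^esub> y j)"
    if f: "lfun f" and y: "y \<in> J \<rightarrow> carrier K" and v: "v \<in> carrier V" for f y v
  proof -
    have yc [simp]: "j \<in> J \<Longrightarrow> y j \<in> carrier K" for j using y by auto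
    have "f (op y v) = (\<Oplus>\<^bsub>K\<^esub>j\<in>J. f ((k (fst j) v \<otimes>\<^bsub>K\<^esub> y j) \<odot> snd j))"
      unfolding op_def using v by (intro lfun_finsum[OF f J] Pi_I; simp)
    also have "\<dots> = (\<Oplus>\<^bsub>K\<^esub>j\<in>J. (k (fst j) v \<otimes>\<^bsub>K\<^esub> f (snd j)) \<otimes>\<^bsub>K\<^esub> y j)"
      using v f by (intro K.finsum_cong' refl Pi_I; simp add: lfun_smult K.m_ac)
    finally show ?thesis .
  qed
  \<comment> \<open>The tag \<open>None\<close> marks the normalisation \<open>f = q X f p Y\<close>
    and \<open>Some T\<close> the commutation with \<open>T\<close>. The pair \<open>(e, d)\<close>
    selects a scalar equation: evaluate at \<open>e\<close>, then take the coordinate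
    \<open>d\<close>.\<close>
  define I where "I = (insert None (Some ` Ts)) \<times> E \<times> E"
  have I: "finite I" using E Ts by (simp add: I_def)
  define L where "L i j X Y = (case i of
      (None, e, d) \<Rightarrow> (if j = (e, d) then \<one>\<^bsub>K\<^esub> else \<zero>\<^bsub>K\<^esub>) \<ominus>\<^bsub>K\<^esub> k (fst j) (p Y e) \<otimes>\<^bsub>K\<^esub> k d (q X (snd j))
    | (Some T, e, d) \<Rightarrow> k (fst j) (T (p Y e)) \<otimes>\<^bsub>K\<^esub> k d (q X (snd j))
        \<ominus>\<^bsub>K\<^esub> k (fst j) (p Y e) \<otimes>\<^bsub>K\<^esub> k d (q X (T (snd j))))" for i j X Y
  have diff_sum: "(\<Oplus>\<^bsub>K\<^esub>j\<in>J. (a j \<ominus>\<^bsub>K\<^esub> b j) \<otimes>\<^bsub>K\<^esub> y j)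
      = (\<Oplus>\<^bsub>K\<^esub>j\<in>J. a j \<otimes>\<^bsub>K\<^esub> y j) \<ominus>\<^bsub>K\<^esub> (\<Oplus>\<^bsub>K\<^esub>j\<in>J. b j \<otimes>\<^bsub>K\<^esub> y j)"
    if "a \<in> J \<rightarrow> carrier K" "b \<in> J \<rightarrow> carrier K" "y \<in> J \<rightarrow> carrier K" for a b y
  proof -
    have [simp]: "j \<in> J \<Longrightarrow> a j \<in> carrier K" "j \<in> J \<Longrightarrow> b j \<in> carrier K" "j \<in> J \<Longrightarrow> y j \<in> carrier K" for j
      using that by auto
    have "(\<Oplus>\<^bsub>K\<^esub>j\<in>J. (a j \<ominus>\<^bsub>K\<^esub> b j) \<otimes>\<^bsub>K\<^esub> y j)
        = (\<Oplus>\<^bsub>K\<^esub>j\<in>J. a j \<otimes>\<^bsub>K\<^esub> y j \<oplus>\<^bsub>K\<^esub> (\<ominus>\<^bsub>K\<^esub> \<one>\<^bsub>K\<^esub>) \<otimes>\<^bsub>K\<^esub> (b j \<otimes>\<^bsub>K\<^esub> y j))"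
      by (intro K.finsum_cong') (auto simp: K.minus_eq K.l_distr K.l_minus)
    also have "\<dots> = (\<Oplus>\<^bsub>K\<^esub>j\<in>J. a j \<otimes>\<^bsub>K\<^esub> y j) \<oplus>\<^bsub>K\<^esub> (\<ominus>\<^bsub>K\<^esub> \<one>\<^bsub>K\<^esub>) \<otimes>\<^bsub>K\<^esub> (\<Oplus>\<^bsub>K\<^esub>j\<in>J. b j \<otimes>\<^bsub>K\<^esub> y j)"
      using J by (subst K.finsum_rdistr) (auto intro!: K.finsum_addf)
    also have "\<dots> = (\<Oplus>\<^bsub>K\<^esub>j\<in>J. a j \<otimes>\<^bsub>K\<^esub> y j) \<ominus>\<^bsub>K\<^esub> (\<Oplus>\<^bsub>K\<^esub>j\<in>J. b j \<otimes>\<^bsub>K\<^esub> y j)"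
      by (simp add: K.minus_eq K.l_minus K.finsum_closed)
    finally show ?thesis .
  qed
  have row_None: "(\<Oplus>\<^bsub>K\<^esub>j\<in>J. L (None, e, d) j X Y \<otimes>\<^bsub>K\<^esub> y j) = y (e, d) \<ominus>\<^bsub>K\<^esub> k d (q X (op y (p Y e)))"
    if e: "e \<in> E" and d: "d \<in> E" and y: "y \<in> J \<rightarrow> carrier K" for e d X Y y
  proof -
    have yc [simp]: "j \<in> J \<Longrightarrow> y j \<in> carrier K" for j using y by auto
    have "(\<Oplus>\<^bsub>K\<^esub>j\<in>J. (if j = (e, d) then \<one>\<^bsub>K\<^esub> else \<zero>\<^bsub>K\<^esub>) \<otimes>\<^bsub>K\<^esub> y j)
        = (\<Oplus>\<^bsub>K\<^esub>j\<in>J. if (e, d) = j then y j else \<zero>\<^bsub>K\<^esub>)"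
      by (intro K.finsum_cong') auto
    also have "\<dots> = y (e, d)"
      using J e d by (intro K.finsum_singleton) (auto simp: J_def y)
    finally show ?thesis
      unfolding L_def using e d y op_eval[OF lfun_lmap[OF k q] y, of d "p Y e"]
      by (simp, subst diff_sum; (intro Pi_I)?; simp add: Pi_iff)
  qed
  have row_Some: "(\<Oplus>\<^bsub>K\<^esub>j\<in>J. L (Some T, e, d) j X Y \<otimes>\<^bsub>K\<^esub> y j)
      = k d (q X (op y (T (p Y e)))) \<ominus>\<^bsub>K\<^esub> k d (q X (T (op y (p Y e))))"
    if e: "e \<in> E" and d: "d \<in> E" and y: "y \<in> J \<rightarrow> carrier K" and T: "T \<in> Ts" for T e d X Y y
    unfolding L_def
    using e d y Ts(2)[OF T] op_eval[OF lfun_lmap[OF k q] y, of d "T (p Y e)"]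
      op_eval[OF lfun_lmap[OF k lmap_compose[OF q Ts(2)[OF T]]] y, of d "p Y e"]
    by (simp, subst diff_sum; (intro Pi_I)?; simp add: Pi_iff)
  show ?thesis
  proof (rule K.finite_of_linear_systems[OF J I, where L = L and P = "(\<subseteq>)"])
    show "K.fin_rank (L i j)" if ij: "i \<in> I" "j \<in> J" for i j
    proof -
      obtain o' e d where i: "i = (o', e, d)" "e \<in> E" "d \<in> E" "o' \<in> insert None (Some ` Ts)"
        using ij(1) by (auto simp: I_def)
      have prod: "K.fin_rank (\<lambda>X Y. a Y \<otimes>\<^bsub>K\<^esub> b X)" if "\<And>Y. a Y \<in> carrier K" "\<And>X. b X \<in> carrier K" for a b
        using K.fin_rank_swap[OF K.fin_rank_prod[of a b]] that by auto
      show ?thesis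
      proof (cases o')
        case None
        have "L i j = (\<lambda>X Y. (if j = (e, d) then \<one>\<^bsub>K\<^esub> else \<zero>\<^bsub>K\<^esub>) \<ominus>\<^bsub>K\<^esub> k (fst j) (p Y e) \<otimes>\<^bsub>K\<^esub> k d (q X (snd j)))"
          by (simp add: fun_eq_iff L_def i None)
        then show ?thesis
          using i ij(2) by (simp only:) (intro K.fin_rank_diff K.fin_rank_const prod; simp)
      next
        case (Some T)
        then have T: "lmap T" using i Ts by auto
        have "L i j = (\<lambda>X Y. k (fst j) (T (p Y e)) \<otimes>\<^bsub>K\<^esub> k d (q X (snd j))
            \<ominus>\<^bsub>K\<^esub> k (fst j) (p Y e) \<otimes>\<^bsub>K\<^esub> k d (q X (T (snd j))))"
          by (simp add: fun_eq_iff L_def i Some)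
        then show ?thesis
          using i ij(2) T by (simp only:) (intro K.fin_rank_diff prod; simp)
      qed
    qed
    show "\<forall>j\<in>J. y j = \<zero>\<^bsub>K\<^esub>"
      if N: "N \<in> \<N>" and y: "y \<in> J \<rightarrow> carrier K"
        and sol: "\<And>i. i \<in> I \<Longrightarrow> (\<Oplus>\<^bsub>K\<^esub>j\<in>J. L i j N N \<otimes>\<^bsub>K\<^esub> y j) = \<zero>\<^bsub>K\<^esub>" for N y
    proof -
      note f = op_lmap[OF y]
      have comm: "q N (op y (T n)) = q N (T (op y n))" if T: "T \<in> Ts" and n: "n \<in> N" for T n
      proof -
        note T' [simp] = Ts(2)[OF T]
        \<comment> \<open>The difference of the two sides as a linear map on the whole space. The
          rows for \<open>T\<close> say that it vanishes on \<open>E\<close>, hence everywhere; on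
          \<open>N\<close> the projection \<open>p N\<close> disappears from it.\<close>
        define g where "g v = q N (op y (T (p N v))) \<ominus> q N (T (op y (p N v)))" for v
        have g: "lmap g"
          unfolding g_def lmap_def using f
          by (auto simp: lmap_add lmap_smult V.minus_eq V.minus_add V.a_ac V.smult_r_distr V.smult_r_minus)
        have gE: "g e = \<zero>" if e: "e \<in> E" for e
        proof (rule frame0)
          show "g e \<in> carrier V" using g e by simp
          show "k d (g e) = \<zero>\<^bsub>K\<^esub>" if d: "d \<in> E" for d
          proof -
            have a: "q N (op y (T (p N e))) \<in> carrier V" "q N (T (op y (p N e))) \<in> carrier V"
              using e f by simp_all
            have "(Some T, e, d) \<in> I" using T e d by (simp add: I_def)
            from sol[OF this] row_Some[OF e d y T]
            have eq: "k d (q N (op y (T (p N e)))) = k d (q N (T (op y (p N e))))"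
              using a d by (simp add: K.minus_eq_zero_iff)
            have "q N (op y (T (p N e))) = g e \<oplus> q N (T (op y (p N e)))"
              using a by (simp add: g_def V.minus_eq V.a_assoc V.l_neg)
            then have "k d (q N (op y (T (p N e)))) = k d (g e) \<oplus>\<^bsub>K\<^esub> k d (q N (T (op y (p N e))))"
              using a d g e by (simp add: lfun_add)
            with eq have "k d (q N (T (op y (p N e)))) = k d (g e) \<oplus>\<^bsub>K\<^esub> k d (q N (T (op y (p N e))))"
              by simp
            then show ?thesis
              using a d g e by (subst (asm) K.add.r_cancel_one') auto
          qed
        qed
        have nV: "n \<in> carrier V" using NV N n by blast
        have "g n = g (comb E (\<lambda>e. k e n))"
          by (rule arg_cong[OF bspec[OF frame nV]])
        also have "\<dots> = (\<Oplus>e\<in>E. g (k e n \<odot> e))"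
          using nV by (intro lmap_finsum[OF g E(1)]) auto
        also have "\<dots> = (\<Oplus>e\<in>E. \<zero>)"
          using nV g by (intro V.finsum_cong') (auto simp: lmap_smult gE)
        finally have "g n = \<zero>" by simp
        then show ?thesis
          using f nV by (simp add: g_def pid[OF N n] V.minus_eq_zero_iff)
      qed
      have fN: "op y n \<in> N" if n: "n \<in> N" for n
      proof (rule rigid[OF N f _ n])
        fix T m assume T: "T \<in> Ts" and m: "m \<in> N"
        have mV: "m \<in> carrier V" using NV N m by blast
        have "q N (op y (T m) \<ominus> T (op y m)) = \<zero>"
          using comm[OF T m] f Ts(2)[OF T] mV by (simp add: lmap_diff V.minus_eq_zero_iff)
        then show "op y (T m) \<ominus> T (op y m) \<in> N"
          using f Ts(2)[OF T] mV by (intro qN[OF N]) auto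
      qed
      show ?thesis
      proof
        fix j assume "j \<in> J"
        then obtain e d where j: "j = (e, d)" "e \<in> E" "d \<in> E" by (auto simp: J_def)
        have "(None, e, d) \<in> I" using j by (simp add: I_def)
        from sol[OF this] row_None[OF j(2,3) y]
        have "y j \<ominus>\<^bsub>K\<^esub> k d (q N (op y (p N e))) = \<zero>\<^bsub>K\<^esub>" by (simp add: j)
        \<comment> \<open>By rigidity \<open>op y\<close> preserves \<open>N\<close>, so
          \<open>q N\<close> kills its values there, and the normalisation then says that
          \<open>y\<close> is the matrix of the zero map.\<close>
        moreover have "q N (op y (p N e)) = \<zero>"
          using j by (intro q0[OF N] fN pN[OF N]) auto
        moreover have "k d \<zero> = \<zero>\<^bsub>K\<^esub>"
          using lfun_smult[of "k d" "\<zero>\<^bsub>K\<^esub>" \<zero>] j by simp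
        ultimately show "y j = \<zero>\<^bsub>K\<^esub>"
          using y \<open>j \<in> J\<close> by (auto simp: K.minus_eq_zero_iff Pi_iff)
      qed
    qed
    show "\<exists>y\<in>J \<rightarrow> carrier K. (\<forall>i\<in>I. (\<Oplus>\<^bsub>K\<^esub>j\<in>J. L i j X Y \<otimes>\<^bsub>K\<^esub> y j) = \<zero>\<^bsub>K\<^esub>) \<and> (\<exists>j\<in>J. y j \<noteq> \<zero>\<^bsub>K\<^esub>)"
      if XY: "X \<in> \<N>" "Y \<in> \<N>" "\<not> Y \<subseteq> X" for X Y
    proof -
      define g where "g v = q X (p Y v)" for v
      have g: "lmap g" unfolding g_def by (rule lmap_compose[OF q p])
      \<comment> \<open>The matrix of \<open>q X p Y\<close>, which represents the composite of the
        inclusion of \<open>Y\<close> with the quotient map by \<open>X\<close>.\<close>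
      define y where "y j = k (snd j) (g (fst j))" for j
      have y: "y \<in> J \<rightarrow> carrier K" using g by (intro Pi_I; simp add: y_def)
      have ged: "g v = (\<Oplus>d\<in>E. k d (g v) \<odot> d)" if "v \<in> carrier V" for v
        by (rule bspec[OF frame lmap_closed[OF g that]])
      have op_g: "op y v = g v" if v: "v \<in> carrier V" for v
      proof -
        have "op y v = (\<Oplus>e\<in>E. \<Oplus>d\<in>E. (k e v \<otimes>\<^bsub>K\<^esub> k d (g e)) \<odot> d)"
          unfolding op_def J_def y_def using v g E(1) by (subst V.finsum_Times) auto
        also have "\<dots> = (\<Oplus>e\<in>E. k e v \<odot> g e)"
        proof (intro V.finsum_cong' refl)
          fix e assume e: "e \<in> E"
          have "(\<Oplus>d\<in>E. (k e v \<otimes>\<^bsub>K\<^esub> k d (g e)) \<odot> d) = (\<Oplus>d\<in>E. k e v \<odot> (k d (g e) \<odot> d))"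
            using e v g by (intro V.finsum_cong') (auto simp: V.smult_assoc1)
          also have "\<dots> = k e v \<odot> (\<Oplus>d\<in>E. k d (g e) \<odot> d)"
            using e v g E(1) by (intro V.finsum_smult_ldistr[symmetric]) auto
          also have "\<dots> = k e v \<odot> g e"
            using e by (intro arg_cong[OF ged[symmetric]]) auto
          finally show "(\<Oplus>d\<in>E. (k e v \<otimes>\<^bsub>K\<^esub> k d (g e)) \<odot> d) = k e v \<odot> g e" .
        qed (use g v in auto)
        also have "\<dots> = (\<Oplus>e\<in>E. g (k e v \<odot> e))"
          using g v by (intro V.finsum_cong') (auto simp: lmap_smult)
        also have "\<dots> = g (comb E (\<lambda>e. k e v))"
          using v by (intro lmap_finsum[OF g E(1), symmetric]) auto
        also have "\<dots> = g v"
          by (rule arg_cong[OF bspec[OF frame v], symmetric])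
        finally show ?thesis .
      qed
      have gY: "g (p Y v) = g v" if "v \<in> carrier V" for v
        using that by (simp add: g_def pid[OF XY(2) pN[OF XY(2)]])
      have qg: "q X (g v) = g v" if "v \<in> carrier V" for v
        using that by (simp add: g_def qq[OF XY(1)])
      have "(\<Oplus>\<^bsub>K\<^esub>j\<in>J. L i j X Y \<otimes>\<^bsub>K\<^esub> y j) = \<zero>\<^bsub>K\<^esub>" if iI: "i \<in> I" for i
      proof -
        obtain o' e d where i: "i = (o', e, d)" "e \<in> E" "d \<in> E" "o' \<in> insert None (Some ` Ts)"
          using iI by (auto simp: I_def)
        show ?thesis
        proof (cases o')
          case None
          have "q X (op y (p Y e)) = g e"
            using i by (simp add: op_g gY qg)
          then show ?thesis
            using row_None[OF i(2,3) y, of X Y] i g by (simp add: None y_def K.minus_eq K.r_neg)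
        next
          case (Some T)
          then have T: "T \<in> Ts" using i(4) by auto
          note T' [simp] = Ts(2)[OF T]
          have "q X (op y (T (p Y e))) = q X (p Y (T (p Y e)))"
            using i(2) by (simp add: op_g qg) (simp add: g_def)
          also have "\<dots> = q X (T (p Y e))"
            using inv[OF XY(2) T pN[OF XY(2)]] i(2) by (simp add: pid[OF XY(2)])
          also have "\<dots> = q X (T (g e))"
          proof -
            \<comment> \<open>\<open>p Y e\<close> and \<open>g e\<close> differ by an element of
              the invariant subspace \<open>X\<close>, so \<open>q X T\<close> takes the same value
              on both.\<close>
            have "q X (T (p X (p Y e))) = \<zero>"
              using i(2) by (intro q0[OF XY(1)] inv[OF XY(1) T] pN[OF XY(1)]) auto
            then show ?thesis
              using i(2) unfolding g_def by (subst (3) q_def) (simp add: lmap_diff)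
          qed
          also have "\<dots> = q X (T (op y (p Y e)))"
            using i(2) by (simp add: op_g gY)
          finally show ?thesis
            using row_Some[OF i(2,3) y T, of X Y] i(2,3) g
            by (simp add: i(1) Some op_g K.minus_eq K.r_neg)
        qed
      qed
      \<comment> \<open>If the matrix were zero, \<open>q X\<close> would kill every element of
        \<open>Y\<close>, which would put \<open>Y\<close> inside \<open>X\<close>.\<close>
      moreover have "\<exists>j\<in>J. y j \<noteq> \<zero>\<^bsub>K\<^esub>"
      proof (rule ccontr)
        assume "\<not> ?thesis"
        then have "k d (g e) = \<zero>\<^bsub>K\<^esub>" if "e \<in> E" "d \<in> E" for e d
          using that by (force simp: J_def y_def)
        then have gE: "g e = \<zero>" if "e \<in> E" for e
          using that g by (intro frame0) auto
        have "n \<in> X" if n: "n \<in> Y" for n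
        proof -
          have nV: "n \<in> carrier V" using NV[OF XY(2) n] .
          have "g n = g (comb E (\<lambda>e. k e n))"
            by (rule arg_cong[OF bspec[OF frame nV]])
          also have "\<dots> = (\<Oplus>e\<in>E. g (k e n \<odot> e))"
            using nV by (intro lmap_finsum[OF g E(1)]) auto
          also have "\<dots> = (\<Oplus>e\<in>E. \<zero>)"
            using nV g by (intro V.finsum_cong') (auto simp: lmap_smult gE)
          finally have "g n = \<zero>" by simp
          then show "n \<in> X"
            using nV by (intro qN[OF XY(1)]) (auto simp: g_def pid[OF XY(2) n])
        qed
        then show False using XY(3) by blast
      qed
      ultimately show ?thesis using y by blast
    qed
    show "X = Y" if "X \<subseteq> Y" "Y \<subseteq> X" for X Y :: "'c set" using that by blast
  qed
qed

end


section \<open>Factor modules\<close>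

lemma right_submoduleD:
  assumes "right_submodule A M N"
  shows "N \<subseteq> carrier M" "\<zero>\<^bsub>M\<^esub> \<in> N"
    "\<And>x y. x \<in> N \<Longrightarrow> y \<in> N \<Longrightarrow> x \<oplus>\<^bsub>M\<^esub> y \<in> N"
    "\<And>x a. x \<in> N \<Longrightarrow> a \<in> carrier A \<Longrightarrow> x \<triangleleft>\<^bsub>M\<^esub> a \<in> N"
  using assms additive_subgroup.a_subset[of N M] additive_subgroup.zero_closed[of N M]
    additive_subgroup.a_closed[of N M]
  by (auto simp: right_submodule_def)

lemma right_submodule_minus:
  assumes "right_module A M" "right_submodule A M N" "x \<in> N"
  shows "\<ominus>\<^bsub>M\<^esub> x \<in> N"
  using assms additive_subgroup.a_inv_closed[of N M x]
  by (simp add: right_submodule_def right_module_def)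

locale submodule_pair = right_module A M for A and M (structure) +
  fixes N L
  assumes N: "right_submodule A M N" and L: "right_submodule A M L" and LN: "L \<subseteq> N"
begin

lemma N_carrier: "x \<in> N \<Longrightarrow> x \<in> carrier M"
  using right_submoduleD(1)[OF N] by blast

lemma L_carrier: "x \<in> L \<Longrightarrow> x \<in> carrier M"
  using right_submoduleD(1)[OF L] by blast

sublocale L: abelian_subgroup L M
  using L by (intro abelian_subgroupI3 M.abelian_group_axioms) (simp add: right_submodule_def)

lemma coset_eq_iff:
  assumes "x \<in> carrier M" "y \<in> carrier M"
  shows "L +> x = L +> y \<longleftrightarrow> x \<ominus> y \<in> L"
proof -
  have "L +> x = L +> y \<longleftrightarrow> x \<in> L +> y"
    using assms L.a_rcos_self[of x] L.a_repr_independence'[of x y] by auto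
  also have "\<dots> \<longleftrightarrow> x \<ominus> y \<in> L"
    using assms L.a_rcos_module[of y x] by (simp add: M.minus_eq)
  finally show ?thesis .
qed

lemma coset_eq_L_iff:
  assumes "x \<in> carrier M"
  shows "L +> x = L \<longleftrightarrow> x \<in> L"
  using coset_eq_iff[of x \<zero>] assms L_carrier right_submoduleD(1)[OF L]
  by (simp add: M.a_coset_add_zero)

lemma carrier_factor: "carrier (factor_module M N L) = (\<lambda>x. L +> x) ` N"
  by (auto simp: factor_module_def A_RCOSETS_def' a_r_coset_def')

lemma zero_factor: "zero (factor_module M N L) = L"
  by (simp add: factor_module_def)

lemma add_factor:
  assumes "x \<in> N" "y \<in> N"
  shows "(L +> x) \<oplus>\<^bsub>factor_module M N L\<^esub> (L +> y) = L +> (x \<oplus> y)"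
  using L.a_rcos_sum[of x y] assms by (simp add: factor_module_def N_carrier)

text \<open>The action on a coset is defined as a union over all its representatives; all members of
  this union coincide because \<open>L\<close> is stable under the action.\<close>

lemma ract_factor:
  assumes x: "x \<in> N" and a: "a \<in> carrier A"
  shows "(L +> x) \<triangleleft>\<^bsub>factor_module M N L\<^esub> a = L +> (x \<triangleleft> a)"
proof -
  have *: "L +> (z \<triangleleft> a) = L +> (x \<triangleleft> a)" if z: "z \<in> L +> x" for z
  proof -
    obtain l where l: "l \<in> L" "z = l \<oplus> x" using z by (auto simp: a_r_coset_def')
    have c: "l \<triangleleft> a \<in> carrier M" "x \<triangleleft> a \<in> carrier M"
      using a l x by (auto intro!: ract_closed simp: L_carrier N_carrier)
    have "z \<triangleleft> a \<ominus> x \<triangleleft> a = l \<triangleleft> a"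
      using l x a c by (simp add: ract_add_left L_carrier N_carrier M.minus_eq M.a_assoc M.r_neg)
    moreover have "l \<triangleleft> a \<in> L"
      using right_submoduleD(4)[OF L] l a by blast
    ultimately show ?thesis
      using c l x a by (subst coset_eq_iff) (auto simp: L_carrier N_carrier intro!: ract_closed)
  qed
  have "x \<in> L +> x"
    using x by (intro L.a_rcos_self N_carrier)
  then have "(\<Union>z\<in>L +> x. L +> (z \<triangleleft> a)) = L +> (x \<triangleleft> a)"
    by (rule UN_constant_eq) (intro ballI *)
  then show ?thesis by (simp add: factor_module_def)
qed

lemma right_module_factor: "right_module A (factor_module M N L)"
proof -
  let ?F = "factor_module M N L"
  note sub = right_submoduleD(3,4)[OF N]
  have "abelian_group ?F"
  proof (rule abelian_groupI)
    fix X Y Z assume "X \<in> carrier ?F" "Y \<in> carrier ?F" "Z \<in> carrier ?F"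
    then obtain x y z where xyz: "X = L +> x" "Y = L +> y" "Z = L +> z" "x \<in> N" "y \<in> N" "z \<in> N"
      by (auto simp: carrier_factor)
    show "X \<oplus>\<^bsub>?F\<^esub> Y \<in> carrier ?F"
      using xyz by (auto simp: add_factor carrier_factor sub)
    show "X \<oplus>\<^bsub>?F\<^esub> Y \<oplus>\<^bsub>?F\<^esub> Z = X \<oplus>\<^bsub>?F\<^esub> (Y \<oplus>\<^bsub>?F\<^esub> Z)"
      using xyz by (auto simp: add_factor sub M.a_assoc N_carrier)
    show "X \<oplus>\<^bsub>?F\<^esub> Y = Y \<oplus>\<^bsub>?F\<^esub> X"
      using xyz by (auto simp: add_factor M.a_comm N_carrier)
  next
    have z: "zero ?F = L +> \<zero>"
      using L_carrier by (simp add: zero_factor M.a_coset_add_zero subsetI)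
    show "zero ?F \<in> carrier ?F"
      unfolding z carrier_factor using right_submoduleD(2)[OF N] by blast
    fix X assume "X \<in> carrier ?F"
    then obtain x where x: "X = L +> x" "x \<in> N" by (auto simp: carrier_factor)
    show "zero ?F \<oplus>\<^bsub>?F\<^esub> X = X"
      unfolding z using x right_submoduleD(2)[OF N] by (simp add: add_factor N_carrier)
    show "\<exists>Y\<in>carrier ?F. Y \<oplus>\<^bsub>?F\<^esub> X = zero ?F"
    proof (rule bexI)
      have m: "\<ominus> x \<in> N" using right_submodule_minus[OF right_module_axioms N] x by blast
      show "(L +> (\<ominus> x)) \<oplus>\<^bsub>?F\<^esub> X = zero ?F"
        unfolding z using x m by (simp add: add_factor N_carrier M.l_neg)
      show "L +> (\<ominus> x) \<in> carrier ?F" using m by (auto simp: carrier_factor)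
    qed
  qed
  moreover have "right_module_axioms A ?F"
  proof
    fix X Y a b
    assume a: "a \<in> carrier A" and "X \<in> carrier ?F"
    then obtain x where x: "X = L +> x" "x \<in> N" by (auto simp: carrier_factor)
    show "X \<triangleleft>\<^bsub>?F\<^esub> a \<in> carrier ?F"
      using x a by (auto simp: ract_factor carrier_factor sub)
    show "X \<triangleleft>\<^bsub>?F\<^esub> (a \<oplus>\<^bsub>A\<^esub> b) = X \<triangleleft>\<^bsub>?F\<^esub> a \<oplus>\<^bsub>?F\<^esub> X \<triangleleft>\<^bsub>?F\<^esub> b" if "b \<in> carrier A"
      using x a that by (auto simp: ract_factor add_factor sub ract_add_right N_carrier)
    show "X \<triangleleft>\<^bsub>?F\<^esub> (a \<otimes>\<^bsub>A\<^esub> b) = X \<triangleleft>\<^bsub>?F\<^esub> a \<triangleleft>\<^bsub>?F\<^esub> b" if "b \<in> carrier A"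
      using x a that by (auto simp: ract_factor sub ract_mult N_carrier)
    show "(X \<oplus>\<^bsub>?F\<^esub> Y) \<triangleleft>\<^bsub>?F\<^esub> a = X \<triangleleft>\<^bsub>?F\<^esub> a \<oplus>\<^bsub>?F\<^esub> Y \<triangleleft>\<^bsub>?F\<^esub> a" if Y: "Y \<in> carrier ?F"
    proof -
      obtain y where y: "Y = L +> y" "y \<in> N" using Y by (auto simp: carrier_factor)
      show ?thesis
        using x a y by (auto simp: ract_factor add_factor sub ract_add_left N_carrier)
    qed
  next
    fix X assume "X \<in> carrier ?F"
    then obtain x where x: "X = L +> x" "x \<in> N" by (auto simp: carrier_factor)
    then show "X \<triangleleft>\<^bsub>?F\<^esub> \<one>\<^bsub>A\<^esub> = X"
      by (auto simp: ract_factor ract_one N_carrier)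
  qed
  ultimately show ?thesis
    by (intro right_module.intro A.ring_axioms)
qed

text \<open>The universal property of \<open>N / L\<close>. Compatibility with \<open>L\<close> is
  stated as equality of values, so no subtraction in \<open>Z\<close> occurs.\<close>

lemma ex_hom_factor:
  assumes k: "\<And>x. x \<in> N \<Longrightarrow> k x \<in> carrier Z"
    and add: "\<And>x y. x \<in> N \<Longrightarrow> y \<in> N \<Longrightarrow> k (x \<oplus> y) = k x \<oplus>\<^bsub>Z\<^esub> k y"
    and ract: "\<And>x a. x \<in> N \<Longrightarrow> a \<in> carrier A \<Longrightarrow> k (x \<triangleleft> a) = k x \<triangleleft>\<^bsub>Z\<^esub> a"
    and cong: "\<And>x y. x \<in> N \<Longrightarrow> y \<in> N \<Longrightarrow> x \<ominus> y \<in> L \<Longrightarrow> k x = k y"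
  shows "\<exists>h\<in>rmod_hom A (factor_module M N L) Z. \<forall>x\<in>N. h (L +> x) = k x"
proof -
  let ?F = "factor_module M N L"
  define h where "h = (\<lambda>X\<in>carrier ?F. k (SOME x. x \<in> N \<and> X = L +> x))"
  have h: "h (L +> x) = k x" if x: "x \<in> N" for x
  proof -
    define y where "y = (SOME y. y \<in> N \<and> L +> x = L +> y)"
    have y: "y \<in> N" "L +> x = L +> y"
      unfolding y_def using someI[of "\<lambda>y. y \<in> N \<and> L +> x = L +> y" x] x by auto
    have "k x = k y"
      using x y by (intro cong) (auto simp: coset_eq_iff N_carrier)
    then show ?thesis
      using x by (auto simp: h_def y_def[symmetric] carrier_factor)
  qed
  note sub = right_submoduleD(3,4)[OF N]
  have "h \<in> rmod_hom A ?F Z"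
    unfolding rmod_hom_def
  proof (intro CollectI conjI ballI)
    have "h X \<in> carrier Z" if "X \<in> carrier ?F" for X
      using that h k by (auto simp: carrier_factor)
    then show "h \<in> carrier ?F \<rightarrow>\<^sub>E carrier Z" by (auto simp: h_def)
    fix X assume "X \<in> carrier ?F"
    then obtain x where x: "X = L +> x" "x \<in> N" by (auto simp: carrier_factor)
    show "h (X \<oplus>\<^bsub>?F\<^esub> Y) = h X \<oplus>\<^bsub>Z\<^esub> h Y" if Y: "Y \<in> carrier ?F" for Y
    proof -
      obtain y where y: "Y = L +> y" "y \<in> N" using Y by (auto simp: carrier_factor)
      show ?thesis using x y by (simp add: add_factor h sub add)
    qed
    show "h (X \<triangleleft>\<^bsub>?F\<^esub> a) = h X \<triangleleft>\<^bsub>Z\<^esub> a" if "a \<in> carrier A" for a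
      using x that by (simp add: ract_factor h sub ract)
  qed
  then show ?thesis using h by blast
qed

end

section \<open>Homomorphisms\<close>

lemma rmod_homD:
  assumes "f \<in> rmod_hom A M N"
  shows "x \<in> carrier M \<Longrightarrow> f x \<in> carrier N"
    "x \<in> carrier M \<Longrightarrow> y \<in> carrier M \<Longrightarrow> f (x \<oplus>\<^bsub>M\<^esub> y) = f x \<oplus>\<^bsub>N\<^esub> f y"
    "x \<in> carrier M \<Longrightarrow> a \<in> carrier A \<Longrightarrow> f (x \<triangleleft>\<^bsub>M\<^esub> a) = f x \<triangleleft>\<^bsub>N\<^esub> a"
  using assms by (auto simp: rmod_hom_def)

lemma rmod_homI:
  assumes "right_module A M"
    and "\<And>x. x \<in> carrier M \<Longrightarrow> f x \<in> carrier N"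
    and "\<And>x y. x \<in> carrier M \<Longrightarrow> y \<in> carrier M \<Longrightarrow> f (x \<oplus>\<^bsub>M\<^esub> y) = f x \<oplus>\<^bsub>N\<^esub> f y"
    and "\<And>x a. x \<in> carrier M \<Longrightarrow> a \<in> carrier A \<Longrightarrow> f (x \<triangleleft>\<^bsub>M\<^esub> a) = f x \<triangleleft>\<^bsub>N\<^esub> a"
  shows "restrict f (carrier M) \<in> rmod_hom A M N"
proof -
  interpret right_module A M by fact
  show ?thesis
    using assms(2-) by (auto simp: rmod_hom_def ract_closed)
qed

lemma rmod_hom_zero:
  assumes "right_module A M" "right_module A N" "f \<in> rmod_hom A M N"
  shows "f \<zero>\<^bsub>M\<^esub> = \<zero>\<^bsub>N\<^esub>"
proof -
  interpret M: right_module A M by fact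
  interpret N: right_module A N by fact
  have "f \<zero>\<^bsub>M\<^esub> \<oplus>\<^bsub>N\<^esub> f \<zero>\<^bsub>M\<^esub> = f \<zero>\<^bsub>M\<^esub>"
    using rmod_homD(2)[OF assms(3), of "\<zero>\<^bsub>M\<^esub>" "\<zero>\<^bsub>M\<^esub>"] by simp
  then show ?thesis
    using rmod_homD(1)[OF assms(3), of "\<zero>\<^bsub>M\<^esub>"] by (metis N.add.r_cancel_one' M.zero_closed)
qed

lemma rmod_hom_diff:
  assumes "right_module A M" "right_module A N" "f \<in> rmod_hom A M N" "x \<in> carrier M" "y \<in> carrier M"
  shows "f (x \<ominus>\<^bsub>M\<^esub> y) = f x \<ominus>\<^bsub>N\<^esub> f y"
proof -
  interpret M: right_module A M by fact
  interpret N: right_module A N by fact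
  have "f (x \<ominus>\<^bsub>M\<^esub> y) \<oplus>\<^bsub>N\<^esub> f y = f x"
    using assms(4,5) by (simp add: rmod_homD(2)[OF assms(3), symmetric] M.minus_eq M.a_assoc M.l_neg)
  then show ?thesis
    using assms(4,5) rmod_homD(1)[OF assms(3)]
    by (metis N.add.inv_solve_right M.minus_closed N.minus_eq)
qed

lemma rmod_hom_compose:
  assumes "right_module A M" "f \<in> rmod_hom A M N" "g \<in> rmod_hom A N P"
  shows "compose (carrier M) g f \<in> rmod_hom A M P"
  unfolding compose_def using assms rmod_homD[OF assms(2)] rmod_homD[OF assms(3)]
  by (intro rmod_homI) auto

lemma rmod_iso_sym:
  assumes M: "right_module A M" and N: "right_module A N" and "rmod_iso A M N"
  shows "rmod_iso A N M"
proof -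
  interpret M: right_module A M by fact
  obtain f where f: "f \<in> rmod_hom A M N" "bij_betw f (carrier M) (carrier N)"
    using assms(3) by (auto simp: rmod_iso_def)
  define g where "g = inv_into (carrier M) f"
  have gc: "g y \<in> carrier M" "f (g y) = y" if "y \<in> carrier N" for y
    using f(2) that by (auto simp: g_def bij_betw_def inv_into_into f_inv_into_f)
  have gf: "g (f x) = x" if "x \<in> carrier M" for x
    using f(2) that by (auto simp: g_def bij_betw_def)
  have "restrict g (carrier N) \<in> rmod_hom A N M"
  proof (rule rmod_homI[OF N])
    show "g (x \<oplus>\<^bsub>N\<^esub> y) = g x \<oplus>\<^bsub>M\<^esub> g y" if "x \<in> carrier N" "y \<in> carrier N" for x y
      using gf[of "g x \<oplus>\<^bsub>M\<^esub> g y"] that gc by (simp add: rmod_homD(2)[OF f(1)])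
    show "g (x \<triangleleft>\<^bsub>N\<^esub> a) = g x \<triangleleft>\<^bsub>M\<^esub> a" if "x \<in> carrier N" "a \<in> carrier A" for x a
      using gf[of "g x \<triangleleft>\<^bsub>M\<^esub> a"] that gc by (simp add: rmod_homD(3)[OF f(1)] M.ract_closed)
  qed (rule gc)
  moreover have "bij_betw (restrict g (carrier N)) (carrier N) (carrier M)"
    using bij_betw_inv_into[OF f(2)] by (simp add: g_def bij_betw_restrict_eq)
  ultimately show ?thesis unfolding rmod_iso_def by blast
qed

lemma rmod_iso_trans:
  assumes "right_module A M" "rmod_iso A M N" "rmod_iso A N P"
  shows "rmod_iso A M P"
proof -
  obtain f g where f: "f \<in> rmod_hom A M N" "bij_betw f (carrier M) (carrier N)"
    and g: "g \<in> rmod_hom A N P" "bij_betw g (carrier N) (carrier P)"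
    using assms(2,3) by (auto simp: rmod_iso_def)
  have "bij_betw (compose (carrier M) g f) (carrier M) (carrier P)"
    using bij_betw_trans[OF f(2) g(2)] by (simp add: bij_betw_cong[of _ "compose (carrier M) g f" "g \<circ> f"] compose_eq)
  then show ?thesis
    using rmod_hom_compose[OF assms(1) f(1) g(1)] unfolding rmod_iso_def by blast
qed

lemma iso_class_eq:
  assumes "right_module A M" "right_module A N" "rmod_iso A M N"
  shows "iso_class A M = iso_class A N"
  using assms rmod_iso_trans rmod_iso_sym unfolding iso_class_def by blast

text \<open>An endomorphism with a nonzero value is not the zero of a division ring, hence a unit,
  and its inverse in the ring is an inverse map.\<close>

lemma brick_endo_bij:
  assumes B: "brick A B" and e: "e \<in> rmod_hom A B B" and x: "x \<in> carrier B" "e x \<noteq> \<zero>\<^bsub>B\<^esub>"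
  shows "bij_betw e (carrier B) (carrier B)"
proof -
  have "e \<noteq> zero_hom B B" using x by (auto simp: zero_hom_def)
  then have "e \<in> Units (End_ring A B)"
    using B e by (simp add: brick_def division_ring_def End_ring_def)
  then obtain i where i: "i \<in> rmod_hom A B B" "compose (carrier B) i e = (\<lambda>x\<in>carrier B. x)"
    "compose (carrier B) e i = (\<lambda>x\<in>carrier B. x)"
    by (auto simp: Units_def End_ring_def)
  show ?thesis
  proof (rule bij_betw_byWitness[where f' = i])
    show "\<forall>a\<in>carrier B. i (e a) = a" "\<forall>a\<in>carrier B. e (i a) = a"
      using i(2,3) by (auto simp: compose_def fun_eq_iff restrict_def) metis+
    show "e ` carrier B \<subseteq> carrier B" "i ` carrier B \<subseteq> carrier B"
      using rmod_homD(1)[OF e] rmod_homD(1)[OF i(1)] by auto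
  qed
qed

lemma brick_nonzero:
  assumes "brick A B"
  shows "\<exists>x\<in>carrier B. x \<noteq> \<zero>\<^bsub>B\<^esub>"
proof (rule ccontr)
  assume "\<not> ?thesis"
  then have "(\<lambda>x\<in>carrier B. x) = zero_hom B B" by (auto simp: zero_hom_def)
  then show False using assms by (simp add: brick_def division_ring_def End_ring_def)
qed


section \<open>Vanishing of homomorphisms between factor modules\<close>

text \<open>A homomorphism \<open>P / L \<rightarrow> P' / L'\<close> is represented by a map \<open>P \<rightarrow> P'\<close> that is only
  required to be a homomorphism modulo \<open>L'\<close>. This makes passing between different pairs \<open>(P, L)\<close>
  a matter of restriction, without isomorphism theorems.\<close>

definition quot_hom where
  "quot_hom A X P L Y P' L' g \<longleftrightarrow>
     (\<forall>x\<in>P. g x \<in> P') \<and> (\<forall>x\<in>L. g x \<in> L') \<and>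
     (\<forall>x\<in>P. \<forall>y\<in>P. g (x \<oplus>\<^bsub>X\<^esub> y) \<ominus>\<^bsub>Y\<^esub> (g x \<oplus>\<^bsub>Y\<^esub> g y) \<in> L') \<and>
     (\<forall>x\<in>P. \<forall>a\<in>carrier A. g (x \<triangleleft>\<^bsub>X\<^esub> a) \<ominus>\<^bsub>Y\<^esub> g x \<triangleleft>\<^bsub>Y\<^esub> a \<in> L')"

text \<open>Expresses that Hom from \<open>P / L\<close> to \<open>P' / L'\<close> is zero.\<close>

definition hom_orth where
  "hom_orth A X P L Y P' L' \<longleftrightarrow> (\<forall>g. quot_hom A X P L Y P' L' g \<longrightarrow> (\<forall>x\<in>P. g x \<in> L'))"

text \<open>Left exactness of Hom in the second argument: a map into \<open>P' / L'\<close> that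
  vanishes modulo \<open>N'\<close> takes values in \<open>N' / L'\<close>. The same function
  represents all the maps involved.\<close>

lemma hom_orth_target_trans:
  assumes "hom_orth A X P L Y N' L'" "hom_orth A X P L Y P' N'" "L' \<subseteq> N'"
  shows "hom_orth A X P L Y P' L'"
  unfolding hom_orth_def
proof (intro allI impI)
  fix g assume g: "quot_hom A X P L Y P' L' g"
  then have "quot_hom A X P L Y P' N' g"
    using assms(3) unfolding quot_hom_def by blast
  then have "\<forall>x\<in>P. g x \<in> N'"
    using assms(2) by (simp add: hom_orth_def)
  then have "quot_hom A X P L Y N' L' g"
    using g by (simp add: quot_hom_def)
  then show "\<forall>x\<in>P. g x \<in> L'"
    using assms(1) by (simp add: hom_orth_def)
qed

text \<open>The dual step: once the restriction to \<open>N\<close> vanishes modulo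
  \<open>L'\<close>, the map factors through \<open>P / N\<close>.\<close>

lemma hom_orth_source_trans:
  assumes "hom_orth A X N L Y P' L'" "hom_orth A X P N Y P' L'" "N \<subseteq> P"
  shows "hom_orth A X P L Y P' L'"
  unfolding hom_orth_def
proof (intro allI impI)
  fix g assume g: "quot_hom A X P L Y P' L' g"
  then have "quot_hom A X N L Y P' L' g"
    using assms(3) unfolding quot_hom_def by blast
  then have "\<forall>x\<in>N. g x \<in> L'"
    using assms(1) by (simp add: hom_orth_def)
  then have "quot_hom A X P N Y P' L' g"
    using g by (simp add: quot_hom_def)
  then show "\<forall>x\<in>P. g x \<in> L'"
    using assms(2) by (simp add: hom_orth_def)
qed

section \<open>Vanishing of Hom along filtrations\<close>

lemma chain_mono:
  assumes "\<forall>i. Suc i < length Ns \<longrightarrow> Ns ! i \<subseteq> Ns ! Suc i" "i \<le> j" "j < length Ns"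
  shows "Ns ! i \<subseteq> Ns ! j"
  using assms(2,3)
proof (induction j rule: dec_induct)
  case (step n)
  then show ?case using assms(1) by (meson Suc_lessD order_trans)
qed simp

lemma hom_orth_chain_source:
  assumes mono: "\<forall>i. Suc i < length Ns \<longrightarrow> Ns ! i \<subseteq> Ns ! Suc i"
    and step: "\<And>m. i \<le> m \<Longrightarrow> m < j \<Longrightarrow> hom_orth A X (Ns ! Suc m) (Ns ! m) Y P' L'"
    and "i \<le> j" "j < length Ns"
  shows "hom_orth A X (Ns ! j) (Ns ! i) Y P' L'"
  using assms(3,4,2)
proof (induction j rule: dec_induct)
  case base
  then show ?case by (simp add: hom_orth_def quot_hom_def)
next
  case (step n)
  have "hom_orth A X (Ns ! n) (Ns ! i) Y P' L'"
    by (rule step.IH) (use step.prems in simp_all)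
  moreover have "hom_orth A X (Ns ! Suc n) (Ns ! n) Y P' L'"
    by (rule step.prems(2)) (use step.hyps in simp_all)
  moreover have "Ns ! n \<subseteq> Ns ! Suc n"
    using mono step.prems(1) by blast
  ultimately show ?case
    by (rule hom_orth_source_trans)
qed

lemma hom_orth_chain_target:
  assumes mono: "\<forall>i. Suc i < length Ns \<longrightarrow> Ns ! i \<subseteq> Ns ! Suc i"
    and step: "\<And>m. i \<le> m \<Longrightarrow> m < j \<Longrightarrow> hom_orth A X P L Y (Ns ! Suc m) (Ns ! m)"
    and "i \<le> j" "j < length Ns"
  shows "hom_orth A X P L Y (Ns ! j) (Ns ! i)"
  using assms(3,4,2)
proof (induction j rule: dec_induct)
  case base
  then show ?case by (simp add: hom_orth_def quot_hom_def)
next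
  case (step n)
  have "hom_orth A X P L Y (Ns ! n) (Ns ! i)"
    by (rule step.IH) (use step.prems in simp_all)
  moreover have "hom_orth A X P L Y (Ns ! Suc n) (Ns ! n)"
    by (rule step.prems(2)) (use step.hyps in simp_all)
  moreover have "Ns ! i \<subseteq> Ns ! n"
    using chain_mono[OF mono, of i n] step by simp
  ultimately show ?case
    by (rule hom_orth_target_trans)
qed

text \<open>The bridge back to genuine modules: a representing function induces an actual
  homomorphism between the factor modules, to which the hypothesis applies.\<close>

lemma hom_orth_of_factor_homs:
  assumes XP: "submodule_pair A X P L" and YP: "submodule_pair A Y P' L'"
    and zero: "\<And>h x. h \<in> rmod_hom A (factor_module X P L) (factor_module Y P' L') \<Longrightarrow>
      x \<in> carrier (factor_module X P L) \<Longrightarrow> h x = \<zero>\<^bsub>factor_module Y P' L'\<^esub>"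
  shows "hom_orth A X P L Y P' L'"
  unfolding hom_orth_def
proof (intro allI impI)
  fix g assume g: "quot_hom A X P L Y P' L' g"
  interpret X: submodule_pair A X P L by fact
  interpret Y: submodule_pair A Y P' L' by fact
  let ?F = "factor_module Y P' L'"
  have gP: "g x \<in> P'" "g x \<in> carrier Y" if "x \<in> P" for x
    using g that Y.N_carrier by (auto simp: quot_hom_def)
  have add: "L' +>\<^bsub>Y\<^esub> g (x \<oplus>\<^bsub>X\<^esub> y) = L' +>\<^bsub>Y\<^esub> (g x \<oplus>\<^bsub>Y\<^esub> g y)" if "x \<in> P" "y \<in> P" for x y
    using g that gP right_submoduleD(3)[OF X.N] by (subst Y.coset_eq_iff) (auto simp: quot_hom_def)
  have "\<exists>h\<in>rmod_hom A (factor_module X P L) ?F. \<forall>x\<in>P. h (L +>\<^bsub>X\<^esub> x) = L' +>\<^bsub>Y\<^esub> g x"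
  proof (rule X.ex_hom_factor)
    show "L' +>\<^bsub>Y\<^esub> g x \<in> carrier ?F" if "x \<in> P" for x
      using gP that by (auto simp: Y.carrier_factor)
    show "L' +>\<^bsub>Y\<^esub> g (x \<oplus>\<^bsub>X\<^esub> y) = (L' +>\<^bsub>Y\<^esub> g x) \<oplus>\<^bsub>?F\<^esub> (L' +>\<^bsub>Y\<^esub> g y)" if "x \<in> P" "y \<in> P" for x y
      using gP that by (simp add: add Y.add_factor)
    show "L' +>\<^bsub>Y\<^esub> g (x \<triangleleft>\<^bsub>X\<^esub> a) = (L' +>\<^bsub>Y\<^esub> g x) \<triangleleft>\<^bsub>?F\<^esub> a" if "x \<in> P" "a \<in> carrier A" for x a
      using g that gP right_submoduleD(4)[OF X.N that]
      by (simp add: Y.ract_factor Y.coset_eq_iff Y.ract_closed quot_hom_def)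
    show "L' +>\<^bsub>Y\<^esub> g x = L' +>\<^bsub>Y\<^esub> g y" if xy: "x \<in> P" "y \<in> P" "x \<ominus>\<^bsub>X\<^esub> y \<in> L" for x y
    proof -
      have L: "x \<ominus>\<^bsub>X\<^esub> y \<in> P" using xy X.LN by blast
      \<comment> \<open>\<open>g\<close> is only known to be additive modulo \<open>L'\<close>, so a
        difference is handled by writing \<open>x\<close> as a sum.\<close>
      have "x = (x \<ominus>\<^bsub>X\<^esub> y) \<oplus>\<^bsub>X\<^esub> y"
        using xy X.N_carrier by (simp add: X.M.minus_eq X.M.a_assoc X.M.l_neg)
      then have "L' +>\<^bsub>Y\<^esub> g x = L' +>\<^bsub>Y\<^esub> (g (x \<ominus>\<^bsub>X\<^esub> y) \<oplus>\<^bsub>Y\<^esub> g y)"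
        using add[OF L xy(2)] by simp
      also have "\<dots> = L' +>\<^bsub>Y\<^esub> g y"
        using xy L gP g
        by (subst Y.coset_eq_iff) (auto simp: Y.M.minus_eq Y.M.a_assoc Y.M.r_neg quot_hom_def)
      finally show ?thesis .
    qed
  qed
  then obtain h where h: "h \<in> rmod_hom A (factor_module X P L) ?F" "\<forall>x\<in>P. h (L +>\<^bsub>X\<^esub> x) = L' +>\<^bsub>Y\<^esub> g x"
    by blast
  show "\<forall>x\<in>P. g x \<in> L'"
  proof
    fix x assume x: "x \<in> P"
    have "h (L +>\<^bsub>X\<^esub> x) = L'"
      using zero[OF h(1)] x by (auto simp: X.carrier_factor Y.zero_factor)
    then show "g x \<in> L'"
      using h(2) x gP by (auto simp: Y.coset_eq_L_iff)
  qed
qed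

lemma hom_zero_of_hom_orth:
  assumes "right_module A X" "right_module A Y"
    and "hom_orth A X (carrier X) {\<zero>\<^bsub>X\<^esub>} Y (carrier Y) {\<zero>\<^bsub>Y\<^esub>}"
    and h: "h \<in> rmod_hom A X Y" and "x \<in> carrier X"
  shows "h x = \<zero>\<^bsub>Y\<^esub>"
proof -
  interpret Y: right_module A Y by fact
  have "quot_hom A X (carrier X) {\<zero>\<^bsub>X\<^esub>} Y (carrier Y) {\<zero>\<^bsub>Y\<^esub>} h"
    using rmod_homD[OF h] rmod_hom_zero[OF assms(1,2) h]
    by (simp add: quot_hom_def Y.minus_eq Y.M.r_neg Y.ract_closed)
  then show ?thesis
    using assms(3,5) by (simp add: hom_orth_def)
qed

lemma hom_zero_iso:
  assumes rm: "right_module A F" "right_module A G" "right_module A B" "right_module A C"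
    and iso: "rmod_iso A F B" "rmod_iso A G C"
    and zero: "rmod_hom A B C = {zero_hom B C}"
    and h: "h \<in> rmod_hom A F G" and x: "x \<in> carrier F"
  shows "h x = \<zero>\<^bsub>G\<^esub>"
proof -
  interpret G: right_module A G by fact
  obtain f where f: "f \<in> rmod_hom A B F" "bij_betw f (carrier B) (carrier F)"
    using rmod_iso_sym[OF rm(1,3) iso(1)] by (auto simp: rmod_iso_def)
  obtain g where g: "g \<in> rmod_hom A G C" "bij_betw g (carrier G) (carrier C)"
    using iso(2) by (auto simp: rmod_iso_def)
  obtain b where b: "b \<in> carrier B" "x = f b"
    using x f(2) by (auto simp: bij_betw_def)
  have "compose (carrier B) g (compose (carrier B) h f) = zero_hom B C"
    using rmod_hom_compose[OF rm(3) rmod_hom_compose[OF rm(3) f(1) h] g(1)] zero by simp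
  then have "compose (carrier B) g (compose (carrier B) h f) b = zero_hom B C b"
    by simp
  then have "g (h x) = \<zero>\<^bsub>C\<^esub>"
    using b by (simp add: compose_eq zero_hom_def)
  then have "g (h x) = g \<zero>\<^bsub>G\<^esub>"
    by (simp add: rmod_hom_zero[OF rm(2,4) g(1)])
  then show ?thesis
    using g(2) rmod_homD(1)[OF h x] by (auto simp: bij_betw_def inj_on_def)
qed

lemma submodule_chainD:
  assumes "right_module A X" "submodule_chain A X Ns"
  shows "Suc i < length Ns \<Longrightarrow> submodule_pair A X (Ns ! Suc i) (Ns ! i)"
    "Ns ! 0 = {\<zero>\<^bsub>X\<^esub>}" "Ns ! (length Ns - 1) = carrier X" "length Ns - 1 < length Ns"
    "i < length Ns \<Longrightarrow> right_submodule A X (Ns ! i)"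
  using assms
  by (auto simp: submodule_chain_def submodule_pair_def submodule_pair_axioms_def
      hd_conv_nth last_conv_nth)

lemma FiltE:
  assumes "X \<in> Filt A B"
  obtains Ns where "right_module A X" "submodule_chain A X Ns"
    "\<And>i. Suc i < length Ns \<Longrightarrow> rmod_iso A (factor_module X (Ns ! Suc i) (Ns ! i)) B"
  using assms by (auto simp: Filt_def)

text \<open>Any factor of the first filtration and any factor of the second are copies of
  \<open>B\<close> and \<open>C\<close>, so Hom between them is zero; this spreads along both
  chains, one argument at a time.\<close>

lemma hom_zero_Filt:
  assumes X: "X \<in> Filt A B" and Y: "Y \<in> Filt A C"
    and rm: "right_module A B" "right_module A C"
    and zero: "rmod_hom A B C = {zero_hom B C}"
    and h: "h \<in> rmod_hom A X Y" and x: "x \<in> carrier X"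
  shows "h x = \<zero>\<^bsub>Y\<^esub>"
proof -
  obtain Ns where N: "right_module A X" "submodule_chain A X Ns"
    "\<And>i. Suc i < length Ns \<Longrightarrow> rmod_iso A (factor_module X (Ns ! Suc i) (Ns ! i)) B"
    using X by (rule FiltE) blast
  obtain Ns' where N': "right_module A Y" "submodule_chain A Y Ns'"
    "\<And>i. Suc i < length Ns' \<Longrightarrow> rmod_iso A (factor_module Y (Ns' ! Suc i) (Ns' ! i)) C"
    using Y by (rule FiltE) blast
  have step: "hom_orth A X (Ns ! Suc i) (Ns ! i) Y (Ns' ! Suc j) (Ns' ! j)"
    if ij: "Suc i < length Ns" "Suc j < length Ns'" for i j
  proof -
    note p = submodule_chainD(1)[OF N(1,2) ij(1)] submodule_chainD(1)[OF N'(1,2) ij(2)]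
    show ?thesis
      using hom_zero_iso[OF submodule_pair.right_module_factor[OF p(1)]
          submodule_pair.right_module_factor[OF p(2)] rm N(3)[OF ij(1)] N'(3)[OF ij(2)] zero]
      by (intro hom_orth_of_factor_homs p)
  qed
  have mono: "\<forall>i. Suc i < length Ns \<longrightarrow> Ns ! i \<subseteq> Ns ! Suc i"
    "\<forall>i. Suc i < length Ns' \<longrightarrow> Ns' ! i \<subseteq> Ns' ! Suc i"
    using N(2) N'(2) by (auto simp: submodule_chain_def)
  note e = submodule_chainD(2-4)[OF N(1,2)] submodule_chainD(2-4)[OF N'(1,2)]
  have "hom_orth A X (Ns ! (length Ns - 1)) (Ns ! 0) Y (Ns' ! (length Ns' - 1)) (Ns' ! 0)"
  proof (rule hom_orth_chain_source[OF mono(1) _ _ e(3)])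
    fix m assume m: "m < length Ns - 1"
    show "hom_orth A X (Ns ! Suc m) (Ns ! m) Y (Ns' ! (length Ns' - 1)) (Ns' ! 0)"
      by (rule hom_orth_chain_target[OF mono(2) _ _ e(6)]) (use m in \<open>auto intro: step\<close>)
  qed simp
  then show ?thesis
    unfolding e by (rule hom_zero_of_hom_orth[OF N(1) N'(1) _ h x])
qed

lemma brick_chain_hom_orth:
  assumes M: "right_module A M" and bc: "brick_chain_filtration A M Ms Bs" and i: "i \<le> length Bs"
  shows "hom_orth A M (Ms ! i) {\<zero>\<^bsub>M\<^esub>} M (carrier M) (Ms ! i)"
proof -
  have chain: "submodule_chain A M Ms" and len: "length Ms = Suc (length Bs)"
    and brick: "\<And>i. i < length Bs \<Longrightarrow> right_module A (Bs ! i)"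
    and Filt: "\<And>i. i < length Bs \<Longrightarrow> factor_module M (Ms ! Suc i) (Ms ! i) \<in> Filt A (Bs ! i)"
    and zero: "\<And>i j. i < j \<Longrightarrow> j < length Bs \<Longrightarrow>
      rmod_hom A (Bs ! i) (Bs ! j) = {zero_hom (Bs ! i) (Bs ! j)}"
    using bc by (auto simp: brick_chain_filtration_def brick_def)
  have mono: "\<forall>i. Suc i < length Ms \<longrightarrow> Ms ! i \<subseteq> Ms ! Suc i"
    using chain by (auto simp: submodule_chain_def)
  have step: "hom_orth A M (Ms ! Suc m) (Ms ! m) M (Ms ! Suc n) (Ms ! n)"
    if "m < n" "n < length Bs" for m n
    using that len hom_zero_Filt[OF Filt Filt brick brick zero, of m n]
    by (intro hom_orth_of_factor_homs submodule_chainD(1)[OF M chain]) auto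
  \<comment> \<open>The source steps have index below \<open>i\<close> and the target steps index at
    least \<open>i\<close>, so only pairs covered by \<open>step\<close> occur.\<close>
  have "hom_orth A M (Ms ! i) (Ms ! 0) M (Ms ! length Bs) (Ms ! i)"
  proof (rule hom_orth_chain_source[OF mono])
    fix m assume m: "m < i"
    show "hom_orth A M (Ms ! Suc m) (Ms ! m) M (Ms ! length Bs) (Ms ! i)"
      by (rule hom_orth_chain_target[OF mono]) (use m i len in \<open>auto intro: step\<close>)
  qed (use i len in auto)
  then show ?thesis
    using submodule_chainD(2,3)[OF M chain] len by simp
qed


section \<open>The brick of a filtered module\<close>

text \<open>At the first term of the filtration on which \<open>h\<close> is nonzero,
  \<open>h\<close> kills the preceding term and so factors through a copy of
  \<open>B\<close>.\<close>

lemma nonzero_hom_from_brick: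
  assumes X: "X \<in> Filt A B" and B: "right_module A B" and Y: "right_module A Y"
    and h: "h \<in> rmod_hom A X Y" and x: "x \<in> carrier X" "h x \<noteq> \<zero>\<^bsub>Y\<^esub>"
  shows "\<exists>g\<in>rmod_hom A B Y. g ` carrier B \<subseteq> h ` carrier X \<and> (\<exists>b\<in>carrier B. g b \<noteq> \<zero>\<^bsub>Y\<^esub>)"
proof -
  obtain Ns where N: "right_module A X" "submodule_chain A X Ns"
    "\<And>i. Suc i < length Ns \<Longrightarrow> rmod_iso A (factor_module X (Ns ! Suc i) (Ns ! i)) B"
    using X by (rule FiltE) blast
  interpret X: right_module A X by fact
  interpret Y: right_module A Y by fact
  note e = submodule_chainD(2-4)[OF N(1,2)]
  define P where "P i \<longleftrightarrow> i < length Ns \<and> (\<exists>x\<in>Ns ! i. h x \<noteq> \<zero>\<^bsub>Y\<^esub>)" for i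
  have "P (length Ns - 1)" using e x by (auto simp: P_def)
  then obtain i where i: "P i" "\<And>j. j < i \<Longrightarrow> \<not> P j" using exists_least_iff[of P] by auto
  have "\<not> P 0" using e rmod_hom_zero[OF N(1) Y h] by (simp add: P_def)
  then obtain m where m: "i = Suc m" using i(1) by (cases i) auto
  have len: "Suc m < length Ns" using i(1) m by (simp add: P_def)
  have zero: "h x = \<zero>\<^bsub>Y\<^esub>" if "x \<in> Ns ! m" for x
    using i(2)[of m] m len that by (auto simp: P_def)
  interpret p: submodule_pair A X "Ns ! Suc m" "Ns ! m"
    by (rule submodule_chainD(1)[OF N(1,2) len])
  let ?F = "factor_module X (Ns ! Suc m) (Ns ! m)"
  have "\<exists>k\<in>rmod_hom A ?F Y. \<forall>x\<in>Ns ! Suc m. k (Ns ! m +>\<^bsub>X\<^esub> x) = h x"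
  proof (rule p.ex_hom_factor)
    show "h x = h y" if xy: "x \<in> Ns ! Suc m" "y \<in> Ns ! Suc m" "x \<ominus>\<^bsub>X\<^esub> y \<in> Ns ! m" for x y
      using zero[OF xy(3)] rmod_hom_diff[OF N(1) Y h] xy rmod_homD(1)[OF h]
      by (simp add: p.N_carrier Y.M.minus_eq_zero_iff)
  qed (use rmod_homD[OF h] p.N_carrier in auto)
  then obtain k where k: "k \<in> rmod_hom A ?F Y" "\<forall>x\<in>Ns ! Suc m. k (Ns ! m +>\<^bsub>X\<^esub> x) = h x"
    by blast
  obtain f where f: "f \<in> rmod_hom A B ?F" "bij_betw f (carrier B) (carrier ?F)"
    using rmod_iso_sym[OF p.right_module_factor B N(3)[OF len]] by (auto simp: rmod_iso_def)
  have g: "compose (carrier B) k f \<in> rmod_hom A B Y"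
    by (rule rmod_hom_compose[OF B f(1) k(1)])
  have "compose (carrier B) k f b \<in> h ` carrier X" if b: "b \<in> carrier B" for b
  proof -
    obtain x where "x \<in> Ns ! Suc m" "f b = Ns ! m +>\<^bsub>X\<^esub> x"
      using rmod_homD(1)[OF f(1) b] by (auto simp: p.carrier_factor)
    then show ?thesis using b k(2) p.N_carrier by (auto simp: compose_eq)
  qed
  moreover have "\<exists>b\<in>carrier B. compose (carrier B) k f b \<noteq> \<zero>\<^bsub>Y\<^esub>"
  proof -
    obtain x where x: "x \<in> Ns ! Suc m" "h x \<noteq> \<zero>\<^bsub>Y\<^esub>" using i(1) m by (auto simp: P_def)
    have "Ns ! m +>\<^bsub>X\<^esub> x \<in> carrier ?F" using x by (auto simp: p.carrier_factor)
    then obtain b where b: "b \<in> carrier B" "f b = Ns ! m +>\<^bsub>X\<^esub> x"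
      using bij_betw_imp_surj_on[OF f(2)] by (metis imageE)
    show ?thesis using b x k(2) by (intro bexI[of _ b]) (simp_all add: compose_eq)
  qed
  ultimately show ?thesis using g by blast
qed

text \<open>The image of \<open>h\<close> contains the image of a nonzero endomorphism of
  \<open>B\<close>, which is all of \<open>B\<close>.\<close>

lemma hom_to_brick_surj:
  assumes X: "X \<in> Filt A B" and B: "brick A B"
    and h: "h \<in> rmod_hom A X B" and x: "x \<in> carrier X" "h x \<noteq> \<zero>\<^bsub>B\<^esub>"
  shows "h ` carrier X = carrier B"
proof -
  have rB: "right_module A B" using B by (simp add: brick_def)
  obtain g b where g: "g \<in> rmod_hom A B B" "g ` carrier B \<subseteq> h ` carrier X" "b \<in> carrier B" "g b \<noteq> \<zero>\<^bsub>B\<^esub>"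
    using nonzero_hom_from_brick[OF X rB rB h x] by blast
  have "g ` carrier B = carrier B"
    using brick_endo_bij[OF B g(1,3,4)] by (simp add: bij_betw_def)
  then show ?thesis using g(2) rmod_homD(1)[OF h] by auto
qed

text \<open>The top factor of the filtration is a quotient of \<open>X\<close> isomorphic to
  \<open>B\<close>; it exists because a chain of length one would force \<open>X\<close> to be
  zero.\<close>

lemma ex_surj_to_brick:
  assumes X: "X \<in> Filt A B" and B: "right_module A B" and ne: "carrier X \<noteq> {\<zero>\<^bsub>X\<^esub>}"
  shows "\<exists>h\<in>rmod_hom A X B. h ` carrier X = carrier B"
proof -
  obtain Ns where N: "right_module A X" "submodule_chain A X Ns"
    "\<And>i. Suc i < length Ns \<Longrightarrow> rmod_iso A (factor_module X (Ns ! Suc i) (Ns ! i)) B"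
    using X by (rule FiltE) blast
  note e = submodule_chainD(2-4)[OF N(1,2)]
  have "length Ns - 1 \<noteq> 0" using e ne by metis
  then obtain m where m: "length Ns - 1 = Suc m" by (cases "length Ns - 1") auto
  have len: "Suc m < length Ns" and top: "Ns ! Suc m = carrier X" using e m by auto
  interpret p: submodule_pair A X "carrier X" "Ns ! m"
    using submodule_chainD(1)[OF N(1,2) len] by (simp add: top)
  let ?F = "factor_module X (carrier X) (Ns ! m)"
  obtain f where f: "f \<in> rmod_hom A ?F B" "bij_betw f (carrier ?F) (carrier B)"
    using N(3)[OF len] by (auto simp: rmod_iso_def top)
  define h where "h = restrict (\<lambda>x. f (Ns ! m +>\<^bsub>X\<^esub> x)) (carrier X)"
  have "h \<in> rmod_hom A X B"
    unfolding h_def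
    using rmod_homD[OF f(1)]
    by (intro rmod_homI[OF N(1)])
      (auto simp: p.carrier_factor p.add_factor[symmetric] p.ract_factor[symmetric])
  moreover have "h ` carrier X = carrier B"
    using f(2) by (auto simp: h_def bij_betw_def p.carrier_factor image_image)
  ultimately show ?thesis by blast
qed

text \<open>As every nonzero map \<open>X \<rightarrow> C\<close> is surjective, so is every nonzero map \<open>B \<rightarrow> C\<close>, being
  preceded by a surjection \<open>X \<rightarrow> B\<close>; the same holds with \<open>B\<close> and \<open>C\<close> exchanged.\<close>

lemma Filt_brick_unique:
  assumes X: "X \<in> Filt A B" "X \<in> Filt A C" "carrier X \<noteq> {\<zero>\<^bsub>X\<^esub>}" and B: "brick A B" and C: "brick A C"
  shows "rmod_iso A B C"
proof -
  have surj: "\<exists>f\<in>rmod_hom A B C. f ` carrier B = carrier C"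
    if X: "X \<in> Filt A B" "X \<in> Filt A C" and B: "brick A B" and C: "brick A C" for B C
  proof -
    have rB: "right_module A B" and rC: "right_module A C" using B C by (simp_all add: brick_def)
    obtain s where s: "s \<in> rmod_hom A X B" "s ` carrier X = carrier B"
      using ex_surj_to_brick[OF X(1) rB assms(3)] by blast
    obtain t where t: "t \<in> rmod_hom A X C" "t ` carrier X = carrier C"
      using ex_surj_to_brick[OF X(2) rC assms(3)] by blast
    obtain c where "c \<in> carrier C" "c \<noteq> \<zero>\<^bsub>C\<^esub>" using brick_nonzero[OF C] by blast
    then obtain x where x: "x \<in> carrier X" "t x \<noteq> \<zero>\<^bsub>C\<^esub>" using t(2) by (metis imageE)
    obtain f b where f: "f \<in> rmod_hom A B C" "b \<in> carrier B" "f b \<noteq> \<zero>\<^bsub>C\<^esub>"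
      using nonzero_hom_from_brick[OF X(1) rB rC t(1) x] by blast
    obtain y where y: "y \<in> carrier X" "b = s y" using f(2) s(2) by (metis imageE)
    have rX: "right_module A X" using X(1) by (simp add: Filt_def)
    have "compose (carrier X) f s ` carrier X = carrier C"
      using y f(3) by (intro hom_to_brick_surj[OF X(2) C rmod_hom_compose[OF rX s(1) f(1)] y(1)])
        (simp add: compose_eq)
    moreover have "compose (carrier X) f s ` carrier X = f ` carrier B"
      by (simp add: s(2)[symmetric] image_image compose_eq cong: image_cong_simp)
    ultimately show ?thesis using f(1) by blast
  qed
  obtain f where f: "f \<in> rmod_hom A B C" "f ` carrier B = carrier C"
    using surj[OF X(1,2) B C] by blast
  obtain g where g: "g \<in> rmod_hom A C B" "g ` carrier C = carrier B"
    using surj[OF X(2,1) C B] by blast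
  have rB: "right_module A B" using B by (simp add: brick_def)
  \<comment> \<open>Composing the surjections in both directions gives a surjective endomorphism of
    the nonzero module \<open>B\<close>. It is therefore nonzero, hence bijective, and so
    \<open>f\<close> is injective.\<close>
  have im: "compose (carrier B) g f ` carrier B = carrier B"
    using f(2) g(2) image_comp[of g f "carrier B"] by (simp add: compose_eq cong: image_cong_simp)
  obtain b where "b \<in> carrier B" "b \<noteq> \<zero>\<^bsub>B\<^esub>" using brick_nonzero[OF B] by blast
  then obtain x where "x \<in> carrier B" "compose (carrier B) g f x \<noteq> \<zero>\<^bsub>B\<^esub>"
    using im by (metis imageE)
  then have "bij_betw (compose (carrier B) g f) (carrier B) (carrier B)"
    by (rule brick_endo_bij[OF B rmod_hom_compose[OF rB f(1) g(1)]])
  then have "inj_on f (carrier B)"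
    by (auto simp: bij_betw_def inj_on_def compose_eq)
  then show ?thesis
    using f unfolding rmod_iso_def bij_betw_def by blast
qed


section \<open>Finite-dimensional modules\<close>

locale fin_dim_right_module = alg: fin_dim_algebra K A + right_module A M
  for K and A and M (structure) +
  assumes fin_span: "finitely_spanned K (underlying_space A M)"
begin

abbreviation V where "V \<equiv> underlying_space A M"

abbreviation scalar where "scalar c \<equiv> c \<odot>\<^bsub>A\<^esub> \<one>\<^bsub>A\<^esub>"

lemma V_simps [simp]:
  "carrier V = carrier M" "add V = add M" "zero V = zero M" "c \<odot>\<^bsub>V\<^esub> x = x \<triangleleft> scalar c"
  by (simp_all add: underlying_space_def)

lemma V_minus [simp]: "a_inv V = a_inv M" "a_minus V = a_minus M"
  by (simp_all add: fun_eq_iff a_minus_def a_inv_def m_inv_def underlying_space_def)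

lemma scalar_mult:
  assumes "c \<in> carrier K" "a \<in> carrier A"
  shows "scalar c \<otimes>\<^bsub>A\<^esub> a = c \<odot>\<^bsub>A\<^esub> a" "a \<otimes>\<^bsub>A\<^esub> scalar c = c \<odot>\<^bsub>A\<^esub> a"
  using assms by (simp_all add: alg.smult_mult_left alg.smult_mult_right)

text \<open>The elements \<open>c\<close> times one are central in \<open>A\<close>, so the action
  of \<open>A\<close> is linear over \<open>K\<close>.\<close>

lemma ract_smult:
  assumes "c \<in> carrier K" "a \<in> carrier A" "x \<in> carrier M"
  shows "x \<triangleleft> (c \<odot>\<^bsub>A\<^esub> a) = (x \<triangleleft> a) \<triangleleft> scalar c" "x \<triangleleft> (c \<odot>\<^bsub>A\<^esub> a) = (x \<triangleleft> scalar c) \<triangleleft> a"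
proof -
  show "x \<triangleleft> (c \<odot>\<^bsub>A\<^esub> a) = (x \<triangleleft> a) \<triangleleft> scalar c"
    using assms unfolding scalar_mult(2)[OF assms(1,2), symmetric] by (simp only: ract_mult alg.smult_closed alg.A.one_closed)
  show "x \<triangleleft> (c \<odot>\<^bsub>A\<^esub> a) = (x \<triangleleft> scalar c) \<triangleleft> a"
    using assms unfolding scalar_mult(1)[OF assms(1,2), symmetric] by (simp only: ract_mult alg.smult_closed alg.A.one_closed)
qed

lemma vspace_V: "vspace K V"
proof (intro vspace.intro moduleI)
  show "field K" "cring K" by (rule alg.K.field_axioms, rule alg.K.is_cring)
  show "abelian_group V"
    by (rule abelian_groupI) (auto simp: M.a_ac intro: bexI[of _ "\<ominus> x" for x] M.l_neg)
  fix a x assume ax: "a \<in> carrier K" "x \<in> carrier V"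
  show "a \<odot>\<^bsub>V\<^esub> x \<in> carrier V"
    using ax by (simp add: ract_closed)
  show "(a \<otimes>\<^bsub>K\<^esub> b) \<odot>\<^bsub>V\<^esub> x = a \<odot>\<^bsub>V\<^esub> (b \<odot>\<^bsub>V\<^esub> x)" if "b \<in> carrier K" for b
    using ax that ract_smult(1)[of a "scalar b" x] by (simp add: alg.smult_assoc1)
  show "(a \<oplus>\<^bsub>K\<^esub> b) \<odot>\<^bsub>V\<^esub> x = a \<odot>\<^bsub>V\<^esub> x \<oplus>\<^bsub>V\<^esub> b \<odot>\<^bsub>V\<^esub> x" if "b \<in> carrier K" for b
    using ax that by (simp add: alg.smult_l_distr ract_add_right)
  show "a \<odot>\<^bsub>V\<^esub> (x \<oplus>\<^bsub>V\<^esub> y) = a \<odot>\<^bsub>V\<^esub> x \<oplus>\<^bsub>V\<^esub> a \<odot>\<^bsub>V\<^esub> y" if "y \<in> carrier V" for y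
    using ax that by (simp add: ract_add_left)
next
  show "\<one>\<^bsub>K\<^esub> \<odot>\<^bsub>V\<^esub> x = x" if "x \<in> carrier V" for x
    using that by (simp add: ract_one)
qed

lemma lmap_ract:
  assumes a: "a \<in> carrier A"
  shows "vspace.lmap K V (\<lambda>x. x \<triangleleft> a)"
  unfolding vspace.lmap_def[OF vspace_V]
proof (intro conjI ballI)
  show "(c \<odot>\<^bsub>V\<^esub> x) \<triangleleft> a = c \<odot>\<^bsub>V\<^esub> (x \<triangleleft> a)" if "c \<in> carrier K" "x \<in> carrier V" for c x
    using ract_smult[OF that(1) a, of x] that(2) by simp
qed (use a in \<open>auto simp: ract_closed ract_add_left\<close>)

lemma submodule_of_right_submodule:
  assumes "right_submodule A M N"
  shows "submodule N K V"
  using right_submoduleD[OF assms] right_submodule_minus[OF right_module_axioms assms]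
  by (intro module.submoduleI[OF vspace.axioms(2)[OF vspace_V]]) auto

text \<open>The operators are the actions of a finite spanning set of \<open>A\<close>. A linear map
  that commutes with them modulo \<open>N\<close> represents a homomorphism from \<open>N\<close> to
  \<open>M / N\<close>, which vanishes by assumption.\<close>

lemma finite_hom_orth_submodules:
  "finite {N. right_submodule A M N \<and> hom_orth A M N {\<zero>} M (carrier M) N}"
proof -
  interpret V: vspace K V by (rule vspace_V)
  obtain S where S: "finite S" "S \<subseteq> carrier V"
    "\<forall>v\<in>carrier V. \<exists>c\<in>S \<rightarrow> carrier K. v = V.comb S c"
    using fin_span by (auto simp only: finitely_spanned_def)
  obtain G where G: "finite G" "G \<subseteq> carrier A"
    "\<forall>a\<in>carrier A. \<exists>c\<in>G \<rightarrow> carrier K. a = (\<Oplus>\<^bsub>A\<^esub>s\<in>G. c s \<odot>\<^bsub>A\<^esub> s)"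
    using alg.fin_dim by (auto simp only: finitely_spanned_def)
  show ?thesis
  proof (rule V.finite_rigid_subspaces[OF S, where Ts = "(\<lambda>a x. x \<triangleleft> a) ` G"])
    show "finite ((\<lambda>a x. x \<triangleleft> a) ` G)" using G(1) by simp
    show "V.lmap T" if "T \<in> (\<lambda>a x. x \<triangleleft> a) ` G" for T
      using that G(2) lmap_ract by auto
    fix N assume "N \<in> {N. right_submodule A M N \<and> hom_orth A M N {\<zero>} M (carrier M) N}"
    then have N: "right_submodule A M N" and orth: "hom_orth A M N {\<zero>} M (carrier M) N" by auto
    note D = right_submoduleD[OF N]
    have NM: "x \<in> carrier M" if "x \<in> N" for x using that D(1) by blast
    show "submodule N K V" using submodule_of_right_submodule[OF N] .
    show "T n \<in> N" if "T \<in> (\<lambda>a x. x \<triangleleft> a) ` G" "n \<in> N" for T n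
      using that D(4) G(2) by auto
    fix f n
    assume f: "V.lmap f" and n: "n \<in> N"
      and comm: "\<And>T n. T \<in> (\<lambda>a x. x \<triangleleft> a) ` G \<Longrightarrow> n \<in> N \<Longrightarrow> f (T n) \<ominus>\<^bsub>V\<^esub> T (f n) \<in> N"
    have fM: "f x \<in> carrier M" if "x \<in> carrier M" for x
      using V.lmap_closed[OF f] that by simp
    have fadd: "f (x \<oplus> y) = f x \<oplus> f y" if "x \<in> carrier M" "y \<in> carrier M" for x y
      using V.lmap_add[OF f] that by simp
    have fsm: "f (x \<triangleleft> scalar c) = f x \<triangleleft> scalar c" if "c \<in> carrier K" "x \<in> carrier M" for c x
      using V.lmap_smult[OF f] that by simp
    \<comment> \<open>The algebra elements with which \<open>f\<close> commutes on \<open>N\<close>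
      modulo \<open>N\<close>. They form a subspace containing the spanning set, hence all of
      \<open>A\<close>.\<close>
    define W where "W = {a \<in> carrier A. \<forall>x\<in>N. f (x \<triangleleft> a) \<ominus> f x \<triangleleft> a \<in> N}"
    have W_add: "a \<oplus>\<^bsub>A\<^esub> b \<in> W" if ab: "a \<in> W" "b \<in> W" for a b
    proof -
      have "f (x \<triangleleft> (a \<oplus>\<^bsub>A\<^esub> b)) \<ominus> f x \<triangleleft> (a \<oplus>\<^bsub>A\<^esub> b) = (f (x \<triangleleft> a) \<ominus> f x \<triangleleft> a) \<oplus> (f (x \<triangleleft> b) \<ominus> f x \<triangleleft> b)"
        if "x \<in> N" for x
        using ab that NM fM
        by (simp add: W_def ract_add_right fadd ract_closed M.minus_eq M.minus_add M.a_ac)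
      then show ?thesis using ab D(3) by (auto simp: W_def)
    qed
    have W_smult: "c \<odot>\<^bsub>A\<^esub> a \<in> W" if ca: "c \<in> carrier K" "a \<in> W" for c a
    proof -
      have "f (x \<triangleleft> (c \<odot>\<^bsub>A\<^esub> a)) \<ominus> f x \<triangleleft> (c \<odot>\<^bsub>A\<^esub> a) = (f (x \<triangleleft> a) \<ominus> f x \<triangleleft> a) \<triangleleft> scalar c"
        if x: "x \<in> N" for x
      proof -
        have c: "x \<triangleleft> a \<in> carrier M" "f x \<triangleleft> a \<in> carrier M" "f (x \<triangleleft> a) \<in> carrier M"
          using ca x NM fM by (auto simp: W_def ract_closed)
        have "(f (x \<triangleleft> a) \<ominus> f x \<triangleleft> a) \<triangleleft> scalar c = f (x \<triangleleft> a) \<triangleleft> scalar c \<ominus> f x \<triangleleft> a \<triangleleft> scalar c"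
          using c ca V.lmap_diff[OF lmap_ract[of "scalar c"]] by simp
        then show ?thesis
          using ca x NM fM c by (simp add: W_def ract_smult(1)[of c a] fsm)
      qed
      then show ?thesis using ca D(4) by (auto simp: W_def)
    qed
    have GW: "a \<in> W" if "a \<in> G" for a
      using comm[of "\<lambda>x. x \<triangleleft> a"] that G(2) by (auto simp: W_def)
    have f0: "f \<zero> = \<zero>"
      using fadd[of \<zero> \<zero>] fM[of \<zero>] by (metis M.add.r_cancel_one' M.l_zero M.zero_closed)
    have W0: "\<zero>\<^bsub>A\<^esub> \<in> W"
    proof -
      have "x \<triangleleft> \<zero>\<^bsub>A\<^esub> = \<zero>" if "x \<in> carrier M" for x
        using ract_add_right[OF that, of "\<zero>\<^bsub>A\<^esub>" "\<zero>\<^bsub>A\<^esub>"] ract_closed[OF that, of "\<zero>\<^bsub>A\<^esub>"]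
        by (metis M.add.r_cancel_one' alg.M.l_zero alg.M.zero_closed)
      then show ?thesis using NM fM f0 D(2) by (auto simp: W_def)
    qed
    have "a \<in> W" if a: "a \<in> carrier A" for a
    proof -
      obtain c where c: "c \<in> G \<rightarrow> carrier K" "a = (\<Oplus>\<^bsub>A\<^esub>s\<in>G. c s \<odot>\<^bsub>A\<^esub> s)"
        using bspec[OF G(3) a] by blast
      have "(\<Oplus>\<^bsub>A\<^esub>s\<in>F. c s \<odot>\<^bsub>A\<^esub> s) \<in> W" if "finite F" "F \<subseteq> G" for F
        using that
      proof induction
        case empty
        then show ?case using W0 by simp
      next
        case (insert s F)
        have "(\<Oplus>\<^bsub>A\<^esub>s\<in>insert s F. c s \<odot>\<^bsub>A\<^esub> s) = c s \<odot>\<^bsub>A\<^esub> s \<oplus>\<^bsub>A\<^esub> (\<Oplus>\<^bsub>A\<^esub>s\<in>F. c s \<odot>\<^bsub>A\<^esub> s)"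
          using insert.hyps insert.prems c(1) G(2)
          by (intro alg.M.finsum_insert) (auto simp: Pi_iff subset_iff)
        then show ?case
          using insert c(1) GW by (auto intro!: W_add W_smult)
      qed
      then show ?thesis using G(1) c(2) by simp
    qed
    then have "quot_hom A M N {\<zero>} M (carrier M) N f"
      using NM fM f0 D(2)
      by (auto simp: quot_hom_def W_def fadd M.minus_eq M.r_neg)
    then show "f n \<in> N"
      using orth n by (simp add: hom_orth_def)
  qed
qed

end


section \<open>Brick chain filtrations\<close>

lemma brick_chain_submodules:
  assumes "right_module A M" "brick_chain_filtration A M Ms Bs" "N \<in> set Ms"
  shows "right_submodule A M N \<and> hom_orth A M N {\<zero>\<^bsub>M\<^esub>} M (carrier M) N"
proof -
  have "submodule_chain A M Ms" "length Ms = Suc (length Bs)"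
    using assms(2) by (auto simp: brick_chain_filtration_def)
  then show ?thesis
    using assms(3) brick_chain_hom_orth[OF assms(1,2)]
    by (auto simp: in_set_conv_nth submodule_chain_def)
qed

lemma brick_chain_distinct:
  assumes "brick_chain_filtration A M Ms Bs"
  shows "distinct Ms"
proof -
  have mono: "\<forall>i. Suc i < length Ms \<longrightarrow> Ms ! i \<subseteq> Ms ! Suc i"
    and strict: "\<And>i. i < length Bs \<Longrightarrow> Ms ! i \<subset> Ms ! Suc i" and len: "length Ms = Suc (length Bs)"
    using assms by (auto simp: brick_chain_filtration_def submodule_chain_def)
  have "Ms ! i \<noteq> Ms ! j" if "i < j" "j < length Ms" for i j
    using strict[of i] chain_mono[OF mono, of "Suc i" j] that len by auto
  then show ?thesis
    unfolding distinct_conv_nth by (metis nat_neq_iff)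
qed

theorem corollary2p9:
  fixes K :: "'k ring" and A :: "('k, 'a) module" and M :: "('a, 'm) rmod"
  assumes "fin_dim_algebra K A"
    and "fin_dim_module K A M"
  shows "finite {Ms. \<exists>Bs :: ('a, 'b) rmod list. brick_chain_filtration A M Ms Bs} \<and>
         finite {C. \<exists>Ms (Bs :: ('a, 'b) rmod list).
                      brick_chain_filtration A M Ms Bs \<and> C \<in> set (filtration_type A Bs)}"
proof -
  have M: "right_module A M" and "finitely_spanned K (underlying_space A M)"
    using assms(2) by (auto simp: fin_dim_module_def)
  then interpret fin_dim_right_module K A M
    using assms(1) by (intro fin_dim_right_module.intro fin_dim_right_module_axioms.intro)
  define \<N> where "\<N> = {N. right_submodule A M N \<and> hom_orth A M N {\<zero>\<^bsub>M\<^esub>} M (carrier M) N}"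
  have fin: "finite \<N>" unfolding \<N>_def by (rule finite_hom_orth_submodules)
  have in_N: "set Ms \<subseteq> \<N>" if "brick_chain_filtration A M Ms Bs"
    for Ms and Bs :: "('a, 'b) rmod list"
    using brick_chain_submodules[OF M that] by (auto simp: \<N>_def)
  \<comment> \<open>Strict inclusions exclude repetitions, so the length of a chain is bounded by
    the number of available submodules.\<close>
  have "finite {Ms. set Ms \<subseteq> \<N> \<and> distinct Ms}"
    by (rule finite_subset_distinct[OF fin])
  then have chains: "finite {Ms. \<exists>Bs :: ('a, 'b) rmod list. brick_chain_filtration A M Ms Bs}"
    by (rule rev_finite_subset) (use in_N brick_chain_distinct in blast)
  \<comment> \<open>The class of a brick in a type depends only on two consecutive terms of the
    chain. Strict inclusion makes their factor nonzero, so uniqueness of the brick leaves at most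
    one class for each pair.\<close>
  define cls :: "'m set \<times> 'm set \<Rightarrow> ('a, 'b) rmod set set" where
    "cls p = {iso_class A B | B. brick A B \<and> snd p \<subset> fst p \<and> factor_module M (fst p) (snd p) \<in> Filt A B}" for p
  have "finite (cls (N, L))" if "N \<in> \<N>" "L \<in> \<N>" for N L
  proof (cases "cls (N, L) = {}")
    case False
    then obtain B :: "('a, 'b) rmod" where B: "brick A B" "L \<subset> N" "factor_module M N L \<in> Filt A B"
      by (auto simp: cls_def)
    interpret p: submodule_pair A M N L
      using that B(2) by unfold_locales (auto simp: \<N>_def)
    obtain x where x: "x \<in> N" "x \<notin> L" using B(2) by blast
    then have "L +>\<^bsub>M\<^esub> x \<in> carrier (factor_module M N L)" "L +>\<^bsub>M\<^esub> x \<noteq> L"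
      by (auto simp: p.carrier_factor p.coset_eq_L_iff p.N_carrier)
    then have ne: "carrier (factor_module M N L) \<noteq> {\<zero>\<^bsub>factor_module M N L\<^esub>}"
      by (auto simp: p.zero_factor)
    have "iso_class A C = iso_class A B"
      if "brick A C" "factor_module M N L \<in> Filt A C" for C :: "('a, 'b) rmod"
      using that B Filt_brick_unique[OF that(2) B(3) ne that(1) B(1)]
      by (intro iso_class_eq) (auto simp: brick_def)
    then have "cls (N, L) \<subseteq> {iso_class A B}"
      by (auto simp: cls_def)
    then show ?thesis by (rule finite_subset) simp
  qed simp
  then have "finite (\<Union>p\<in>\<N> \<times> \<N>. cls p)"
    using fin by auto
  moreover have "C \<in> (\<Union>p\<in>\<N> \<times> \<N>. cls p)"
    if bc: "brick_chain_filtration A M Ms Bs" and C: "C \<in> set (filtration_type A Bs)"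
    for C Ms and Bs :: "('a, 'b) rmod list"
  proof -
    obtain i where i: "i < length Bs" "C = iso_class A (Bs ! i)"
      using C by (auto simp: filtration_type_def in_set_conv_nth)
    have "Ms ! Suc i \<in> \<N>" "Ms ! i \<in> \<N>"
      using in_N[OF bc] i(1) bc by (auto simp: brick_chain_filtration_def)
    moreover have "C \<in> cls (Ms ! Suc i, Ms ! i)"
      using bc i by (auto simp: cls_def brick_chain_filtration_def)
    ultimately show ?thesis by blast
  qed
  ultimately have "finite {C. \<exists>Ms (Bs :: ('a, 'b) rmod list).
      brick_chain_filtration A M Ms Bs \<and> C \<in> set (filtration_type A Bs)}"
    by (elim finite_subset[rotated]) blast
  with chains show ?thesis by blast
qed

end
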